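(* The embedding in $\mathbb{P}^{13}$ of the Enriques-Fano threefold $W_{BS}^{13}$ of genus $13$ found by Bayle and Sano is the classical Enriques-Fano threefold; that is, up to the choice of coordinates on $\mathbb{P}^{13}$, $W_{BS}^{13}\subset\mathbb{P}^{13}$ coincides with the image of $\mathbb{P}^3$ via the rational map defined by the linear system of the sextic surfaces of $\mathbb{P}^3$ having double points along the six edges of a tetrahedron.
   Context: We work over $\mathbb{C}$. Let $X=\mathbb{P}^1\times\mathbb{P}^1\times\mathbb{P}^1$ and let $\sigma:X\to X$ be the involution $[x_0:x_1]\times[y_0:y_1]\times[z_0:z_1]\mapsto[x_0:-x_1]\times[y_0:-y_1]\times[z_0:-z_1]$. The Enriques-Fano threefold of genus $13$ found by Bayle and Sano is the quotient $W_{BS}^{13}:=X/\sigma$, embedded in $\mathbb{P}^{13}$ by the quotient morphism $\pi:X\to W_{BS}^{13}\subset\mathbb{P}^{13}$ defined by the linear system of the $\sigma$-invariant elements of $|-K_X|$, i.e. by the $14$ $\sigma$-invariant monomials of multidegree $(2,2,2)$: $x_0^2y_0^2z_0^2$, $x_0^2y_0^2z_1^2$, $x_0^2y_0y_1z_0z_1$, $x_0^2y_1^2z_0^2$, $x_0^2y_1^2z_1^2$, $x_0x_1y_0^2z_0z_1$, $x_0x_1y_0y_1z_0^2$, $x_0x_1y_0y_1z_1^2$, $x_0x_1y_1^2z_0z_1$, $x_1^2y_0^2z_0^2$, $x_1^2y_0^2z_1^2$, $x_1^2y_0y_1z_0z_1$, $x_1^2y_1^2z_0^2$, $x_1^2y_1^2z_1^2$.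 The classical Enriques-Fano threefold $W_F^{13}\subset\mathbb{P}^{13}$ is the (closure of the) image of $\mathbb{P}^3$ via the rational map defined by the $13$-dimensional linear system of the sextic surfaces having double points along the six edges of the tetrahedron $\{s_0s_1s_2s_3=0\}\subset\mathbb{P}^3_{[s_0:s_1:s_2:s_3]}$, i.e. the surfaces $$\lambda_0s_1^2s_2^2s_3^2+ \lambda_1s_0^2s_2^2s_3^2+\lambda_2s_0^2s_1^2s_3^2+\lambda_3s_0^2s_1^2s_2^2+ s_0s_1s_2s_3Q(s_0,s_1,s_2,s_3)=0,$$ with $\lambda_i\in\mathbb{C}$ and $Q$ a quadratic form. *)

theory Defs
  imports "HOL-Analysis.Analysis"
begin

section \<open>Complex projective space\<close>

text \<open>The projective space of \<open>complex ^ 'n\<close> is the set of lines through the origin, so that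
  \<open>\<P>\<^sup>1\<close>, \<open>\<P>\<^sup>3\<close> and \<open>\<P>\<^sup>1\<^sup>3\<close> belong to the index types \<open>2\<close>, \<open>4\<close> and \<open>14\<close>. Indices start at \<open>1\<close>, so
  the homogeneous coordinate written \<open>x\<^sub>0\<close> in mathematics is \<open>x $ 1\<close> here.\<close>

definition hpoint :: "complex ^ 'n \<Rightarrow> (complex ^ 'n) set" where
  "hpoint v = vec.span {v}"

definition proj_space :: "(complex ^ 'n) set set" where
  "proj_space = {hpoint v | v. v \<noteq> 0}"

text \<open>Homogeneous forms are taken as functions. Over the infinite field of complex numbers a form
  is determined by its values.\<close>

definition forms :: "nat \<Rightarrow> (complex ^ 'n \<Rightarrow> complex) set" where
  "forms d = {F. \<exists>c. F = (\<lambda>x. \<Sum>e | (\<Sum>i\<in>UNIV. e i) = d. c e * (\<Prod>i\<in>(UNIV :: 'n set). x $ i ^ e i))}"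

definition zariski_closed :: "(complex ^ 'n) set set \<Rightarrow> bool" where
  "zariski_closed Z \<longleftrightarrow> (\<exists>\<F> \<subseteq> (\<Union>d. forms d). Z = {L \<in> proj_space. \<forall>F\<in>\<F>. \<forall>v\<in>L. F v = 0})"

definition zariski_closure :: "(complex ^ 'n) set set \<Rightarrow> (complex ^ 'n) set set" where
  "zariski_closure S = zariski_closed hull S"

definition proj_transform :: "complex ^ 'n ^ 'n \<Rightarrow> (complex ^ 'n) set set \<Rightarrow> (complex ^ 'n) set set" where
  "proj_transform A S = (\<lambda>L. (\<lambda>v. A *v v) ` L) ` S"

section \<open>The Bayle-Sano threefold of genus 13\<close>

definition invol :: "complex ^ 2 \<Rightarrow> complex ^ 2" where
  "invol x = vector [x $ 1, - x $ 2]"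

definition bs_map :: "complex ^ 2 \<Rightarrow> complex ^ 2 \<Rightarrow> complex ^ 2 \<Rightarrow> complex ^ 14" where
  "bs_map x y z = (let x0 = x $ 1; x1 = x $ 2; y0 = y $ 1; y1 = y $ 2; z0 = z $ 1; z1 = z $ 2 in
     vector
      [x0^2 * y0^2 * z0^2,
       x0^2 * y0^2 * z1^2,
       x0^2 * y0 * y1 * z0 * z1,
       x0^2 * y1^2 * z0^2,
       x0^2 * y1^2 * z1^2,
       x0 * x1 * y0^2 * z0 * z1,
       x0 * x1 * y0 * y1 * z0^2,
       x0 * x1 * y0 * y1 * z1^2,
       x0 * x1 * y1^2 * z0 * z1,
       x1^2 * y0^2 * z0^2,
       x1^2 * y0^2 * z1^2,
       x1^2 * y0 * y1 * z0 * z1,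
       x1^2 * y1^2 * z0^2,
       x1^2 * y1^2 * z1^2])"

text \<open>The embedded threefold is the image of \<open>\<P>\<^sup>1 \<times> \<P>\<^sup>1 \<times> \<P>\<^sup>1\<close>. Lemmas \<open>bs_map_nonzero\<close> and
  \<open>bs_map_fibres\<close> below show that the map is defined everywhere and that its fibres are exactly
  the orbits of the involution, so that the points of \<open>W_BS\<close> are those of the quotient.\<close>

definition W_BS :: "(complex ^ 14) set set" where
  "W_BS = {hpoint (bs_map x y z) | x y z. x \<noteq> 0 \<and> y \<noteq> 0 \<and> z \<noteq> 0}"

section \<open>The classical threefold of genus 13\<close>

definition tetrahedron :: "(4 \<Rightarrow> complex ^ 4) \<Rightarrow> bool" where
  "tetrahedron v \<longleftrightarrow> inj v \<and> vec.independent (range v)"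

text \<open>Double means of multiplicity at least two. A form is holomorphic, so its real total
  derivative at a point is zero iff all its complex partial derivatives vanish there.\<close>

definition double_point :: "(complex ^ 'n \<Rightarrow> complex) \<Rightarrow> complex ^ 'n \<Rightarrow> bool" where
  "double_point F p \<longleftrightarrow> F p = 0 \<and> (F has_derivative (\<lambda>_. 0)) (at p)"

definition double_edge_sextics :: "(4 \<Rightarrow> complex ^ 4) \<Rightarrow> (complex ^ 4 \<Rightarrow> complex) set" where
  "double_edge_sextics v =
     {F \<in> forms 6. \<forall>i j. i \<noteq> j \<longrightarrow> (\<forall>p \<in> vec.span {v i, v j}. double_point F p)}"

definition system_basis :: "('i::finite \<Rightarrow> 'a \<Rightarrow> complex) \<Rightarrow> ('a \<Rightarrow> complex) set \<Rightarrow> bool" where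
  "system_basis f V \<longleftrightarrow> range f \<subseteq> V \<and> (\<forall>F\<in>V. \<exists>!c. F = (\<lambda>x. \<Sum>i\<in>UNIV. c i * f i x))"

definition rational_image :: "('m \<Rightarrow> complex ^ 'n \<Rightarrow> complex) \<Rightarrow> (complex ^ 'm) set set" where
  "rational_image f = {hpoint (\<chi> i. f i s) | s. (\<chi> i. f i s) \<noteq> 0}"

section \<open>The fibres of the Bayle-Sano map\<close>

lemma UNIV_14: "(UNIV :: 14 set) = {1,2,3,4,5,6,7,8,9,10,11,12,13,14}"
  by (rule sym, rule card_subset_eq) auto

lemma vec2_nonzero_iff: "(x :: complex ^ 2) \<noteq> 0 \<longleftrightarrow> x $ 1 \<noteq> 0 \<or> x $ 2 \<noteq> 0"
  by (auto simp: vec_eq_iff forall_2)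

lemma invol_nth [simp]: "invol x $ 1 = x $ 1" "invol x $ 2 = - x $ 2"
  by (simp_all add: invol_def)

lemma invol_nonzero [simp]: "invol x \<noteq> 0 \<longleftrightarrow> x \<noteq> 0"
  by (simp add: vec2_nonzero_iff)

lemma hpoint_eq_iff:
  assumes "v \<noteq> 0" "w \<noteq> 0"
  shows "hpoint v = hpoint w \<longleftrightarrow> (\<exists>k. k \<noteq> 0 \<and> v = k *s w)"
proof
  assume "hpoint v = hpoint w"
  then have "v \<in> vec.span {w}"
    by (metis hpoint_def singletonI vec.span_base)
  then obtain k where "v = k *s w"
    by (auto simp: vec.span_singleton)
  with assms show "\<exists>k. k \<noteq> 0 \<and> v = k *s w"
    by (intro exI[of _ k]) auto
next
  assume "\<exists>k. k \<noteq> 0 \<and> v = k *s w"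
  then obtain k where k: "k \<noteq> 0" "v = k *s w" by blast
  have "c *s w \<in> range (\<lambda>k'. k' *s v)" for c
    using k by (intro image_eqI[of _ _ "c / k"]) auto
  then show "hpoint v = hpoint w"
    using k by (auto simp: hpoint_def vec.span_singleton)
qed

lemma hpoint_2_eq_iff:
  fixes x x' :: "complex ^ 2"
  assumes "x \<noteq> 0" "x' \<noteq> 0"
  shows "hpoint x = hpoint x' \<longleftrightarrow> x $ 1 * x' $ 2 = x $ 2 * x' $ 1"
proof
  assume "hpoint x = hpoint x'"
  then show "x $ 1 * x' $ 2 = x $ 2 * x' $ 1"
    using assms by (auto simp: hpoint_eq_iff)
next
  assume eq: "x $ 1 * x' $ 2 = x $ 2 * x' $ 1"
  have "\<exists>k. x = k *s x'"
  proof (cases "x' $ 1 = 0")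
    case True
    then have "x' $ 2 \<noteq> 0" using assms vec2_nonzero_iff by blast
    with True eq show ?thesis
      by (intro exI[of _ "x $ 2 / x' $ 2"]) (auto simp: vec_eq_iff forall_2)
  next
    case False
    with eq show ?thesis
      by (intro exI[of _ "x $ 1 / x' $ 1"]) (auto simp: vec_eq_iff forall_2 field_simps)
  qed
  then obtain k where "x = k *s x'" by blast
  moreover from this have "k \<noteq> 0" using assms by auto
  ultimately show "hpoint x = hpoint x'"
    using assms hpoint_eq_iff by blast
qed

lemma bs_map_nth:
  "bs_map x y z $ 1 = (x $ 1)^2 * (y $ 1)^2 * (z $ 1)^2"
  "bs_map x y z $ 2 = (x $ 1)^2 * (y $ 1)^2 * (z $ 2)^2"
  "bs_map x y z $ 3 = (x $ 1)^2 * y $ 1 * y $ 2 * z $ 1 * z $ 2"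
  "bs_map x y z $ 4 = (x $ 1)^2 * (y $ 2)^2 * (z $ 1)^2"
  "bs_map x y z $ 5 = (x $ 1)^2 * (y $ 2)^2 * (z $ 2)^2"
  "bs_map x y z $ 6 = x $ 1 * x $ 2 * (y $ 1)^2 * z $ 1 * z $ 2"
  "bs_map x y z $ 7 = x $ 1 * x $ 2 * y $ 1 * y $ 2 * (z $ 1)^2"
  "bs_map x y z $ 8 = x $ 1 * x $ 2 * y $ 1 * y $ 2 * (z $ 2)^2"
  "bs_map x y z $ 9 = x $ 1 * x $ 2 * (y $ 2)^2 * z $ 1 * z $ 2"
  "bs_map x y z $ 10 = (x $ 2)^2 * (y $ 1)^2 * (z $ 1)^2"
  "bs_map x y z $ 11 = (x $ 2)^2 * (y $ 1)^2 * (z $ 2)^2"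
  "bs_map x y z $ 12 = (x $ 2)^2 * y $ 1 * y $ 2 * z $ 1 * z $ 2"
  "bs_map x y z $ 13 = (x $ 2)^2 * (y $ 2)^2 * (z $ 1)^2"
  "bs_map x y z $ 14 = (x $ 2)^2 * (y $ 2)^2 * (z $ 2)^2"
  by (simp_all add: bs_map_def Let_def vector_def)

lemma bs_map_eq_iff: "v = w \<longleftrightarrow> (\<forall>i\<in>{1,2,3,4,5,6,7,8,9,10,11,12,13,14}. v $ i = w $ i)"
  for v w :: "complex ^ 14"
  by (simp add: vec_eq_iff flip: UNIV_14)

lemma bs_map_nonzero:
  assumes "x \<noteq> 0" "y \<noteq> 0" "z \<noteq> 0"
  shows "bs_map x y z \<noteq> 0"
  using assms unfolding vec2_nonzero_iff
  by (auto simp: bs_map_eq_iff bs_map_nth)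

lemma bs_map_invol: "bs_map (invol x) (invol y) (invol z) = bs_map x y z"
  by (simp add: bs_map_eq_iff bs_map_nth)

lemma bs_map_scale: "bs_map (a *s x) (b *s y) (c *s z) = (a^2 * b^2 * c^2) *s bs_map x y z"
  by (simp add: bs_map_eq_iff bs_map_nth power2_eq_square mult_ac)

lemma bs_map_fibres_aux:
  fixes x0 x1 y0 y1 Z Z' u0 u1 v0 v1 :: complex
  assumes nz: "x0 \<noteq> 0 \<or> x1 \<noteq> 0" "y0 \<noteq> 0 \<or> y1 \<noteq> 0" "Z \<noteq> 0"
    and eq: "x0^2 * y0^2 * Z = u0^2 * v0^2 * Z'" "x0^2 * y1^2 * Z = u0^2 * v1^2 * Z'"
      "x1^2 * y0^2 * Z = u1^2 * v0^2 * Z'" "x1^2 * y1^2 * Z = u1^2 * v1^2 * Z'"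
      "x0 * x1 * y0 * y1 * Z = u0 * u1 * v0 * v1 * Z'"
  shows "(x0 * u1)^2 = (x1 * u0)^2 \<and> (y0 * v1)^2 = (y1 * v0)^2 \<and>
    (x0 * u1) * (y0 * v1) = (x1 * u0) * (y1 * v0)"
proof -
  have Z': "Z' \<noteq> 0"
    using nz eq by auto
  have p: "(x0 * u1)^2 = (x1 * u0)^2"
  proof -
    have "x0^2 * u1^2 * (y^2 * Z) = x1^2 * u0^2 * (y^2 * Z)"
      if "x0^2 * y^2 * Z = u0^2 * v^2 * Z'" "x1^2 * y^2 * Z = u1^2 * v^2 * Z'" for y v
      using that by algebra
    from this[OF eq(1,3)] this[OF eq(2,4)] show ?thesis
      using nz by (auto simp: power_mult_distrib)
  qed
  have r: "(y0 * v1)^2 = (y1 * v0)^2"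
  proof -
    have "y0^2 * v1^2 * (x^2 * Z) = y1^2 * v0^2 * (x^2 * Z)"
      if "x^2 * y0^2 * Z = u^2 * v0^2 * Z'" "x^2 * y1^2 * Z = u^2 * v1^2 * Z'" for x u
      using that by algebra
    from this[OF eq(1,2)] this[OF eq(3,4)] show ?thesis
      using nz by (auto simp: power_mult_distrib)
  qed
  have "(x0 * u0 * y0 * v0 * (Z * Z')) * ((x0 * u1) * (y0 * v1))
      = (x0 * u0 * y0 * v0 * (Z * Z')) * ((x1 * u0) * (y1 * v0))"
    using eq(1,5) by algebra
  then have "x0 * u0 * y0 * v0 = 0 \<or> (x0 * u1) * (y0 * v1) = (x1 * u0) * (y1 * v0)"
    using nz Z' by auto
  then show ?thesis
    using p r by auto
qed

lemma bs_map_fibres: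
  assumes nz: "x \<noteq> 0" "y \<noteq> 0" "z \<noteq> 0" and nz': "x' \<noteq> 0" "y' \<noteq> 0" "z' \<noteq> 0"
  shows "hpoint (bs_map x y z) = hpoint (bs_map x' y' z') \<longleftrightarrow>
    (hpoint x = hpoint x' \<and> hpoint y = hpoint y' \<and> hpoint z = hpoint z') \<or>
    (hpoint x = hpoint (invol x') \<and> hpoint y = hpoint (invol y') \<and> hpoint z = hpoint (invol z'))"
    (is "?l \<longleftrightarrow> ?r")
proof
  assume ?l
  then obtain k where k: "k \<noteq> 0" "bs_map x y z = k *s bs_map x' y' z'"
    using bs_map_nonzero[OF nz] bs_map_nonzero[OF nz'] hpoint_eq_iff by blast
  then have "bs_map x y z $ i = k * bs_map x' y' z' $ i" for i
    by simp
  note e = this[of 1, unfolded bs_map_nth]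
    this[of 2, unfolded bs_map_nth]
    this[of 3, unfolded bs_map_nth]
    this[of 4, unfolded bs_map_nth]
    this[of 5, unfolded bs_map_nth]
    this[of 6, unfolded bs_map_nth]
    this[of 7, unfolded bs_map_nth]
    this[of 8, unfolded bs_map_nth]
    this[of 9, unfolded bs_map_nth]
    this[of 10, unfolded bs_map_nth]
    this[of 11, unfolded bs_map_nth]
    this[of 12, unfolded bs_map_nth]
    this[of 13, unfolded bs_map_nth]
    this[of 14, unfolded bs_map_nth]
  define p q r s t u where "p = x $ 1 * x' $ 2" and "q = x $ 2 * x' $ 1"
    and "r = y $ 1 * y' $ 2" and "s = y $ 2 * y' $ 1"
    and "t = z $ 1 * z' $ 2" and "u = z $ 2 * z' $ 1"
  note defs = p_def q_def r_def s_def t_def u_def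
  note n = nz[unfolded vec2_nonzero_iff]
  have xy: "p^2 = q^2 \<and> r^2 = s^2 \<and> p * r = q * s"
  proof -
    obtain i where i: "z $ i \<noteq> 0" "i = 1 \<or> i = 2" using n by blast
    from i(2) show ?thesis
    proof (elim disjE)
      assume i': "i = 1"
      show ?thesis unfolding defs
        by (rule bs_map_fibres_aux[of _ _ _ _ "(z $ 1)^2" _ _ "k * (z' $ 1)^2"],
            (use n in simp), (use n in simp), (use i i' in simp),
            (use e in \<open>simp only: mult_ac\<close>)+)
    next
      assume i': "i = 2"
      show ?thesis unfolding defs
        by (rule bs_map_fibres_aux[of _ _ _ _ "(z $ 2)^2" _ _ "k * (z' $ 2)^2"],
            (use n in simp), (use n in simp), (use i i' in simp),
            (use e in \<open>simp only: mult_ac\<close>)+)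
    qed
  qed
  have xz: "p^2 = q^2 \<and> t^2 = u^2 \<and> p * t = q * u"
  proof -
    obtain i where i: "y $ i \<noteq> 0" "i = 1 \<or> i = 2" using n by blast
    from i(2) show ?thesis
    proof (elim disjE)
      assume i': "i = 1"
      show ?thesis unfolding defs
        by (rule bs_map_fibres_aux[of _ _ _ _ "(y $ 1)^2" _ _ "k * (y' $ 1)^2"],
            (use n in simp), (use n in simp), (use i i' in simp),
            (use e in \<open>simp only: mult_ac\<close>)+)
    next
      assume i': "i = 2"
      show ?thesis unfolding defs
        by (rule bs_map_fibres_aux[of _ _ _ _ "(y $ 2)^2" _ _ "k * (y' $ 2)^2"],
            (use n in simp), (use n in simp), (use i i' in simp),
            (use e in \<open>simp only: mult_ac\<close>)+)
    qed
  qed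
  have yz: "r^2 = s^2 \<and> t^2 = u^2 \<and> r * t = s * u"
  proof -
    obtain i where i: "x $ i \<noteq> 0" "i = 1 \<or> i = 2" using n by blast
    from i(2) show ?thesis
    proof (elim disjE)
      assume i': "i = 1"
      show ?thesis unfolding defs
        by (rule bs_map_fibres_aux[of _ _ _ _ "(x $ 1)^2" _ _ "k * (x' $ 1)^2"],
            (use n in simp), (use n in simp), (use i i' in simp),
            (use e in \<open>simp only: mult_ac\<close>)+)
    next
      assume i': "i = 2"
      show ?thesis unfolding defs
        by (rule bs_map_fibres_aux[of _ _ _ _ "(x $ 2)^2" _ _ "k * (x' $ 2)^2"],
            (use n in simp), (use n in simp), (use i i' in simp),
            (use e in \<open>simp only: mult_ac\<close>)+)
    qed
  qed
  have "(p = q \<and> r = s \<and> t = u) \<or> (p = - q \<and> r = - s \<and> t = - u)"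
  proof -
    have "p = q \<or> p = - q" "r = s \<or> r = - s" "t = u \<or> t = - u"
      using xy xz by (auto simp: power2_eq_iff)
    then show ?thesis
      using xy xz yz by (auto simp: mult_minus_left)
  qed
  then show ?r
    using nz nz' by (auto simp: hpoint_2_eq_iff defs)
next
  have *: "hpoint (bs_map x y z) = hpoint (bs_map a b c)"
    if eqs: "hpoint x = hpoint a" "hpoint y = hpoint b" "hpoint z = hpoint c"
      and nz_abc: "a \<noteq> 0" "b \<noteq> 0" "c \<noteq> 0" for a b c
  proof -
    from eqs obtain k l m where "k \<noteq> 0" "l \<noteq> 0" "m \<noteq> 0"
      and "x = k *s a" "y = l *s b" "z = m *s c"
      using nz nz_abc by (auto simp: hpoint_eq_iff)
    then have "bs_map x y z = (k^2 * l^2 * m^2) *s bs_map a b c" "k^2 * l^2 * m^2 \<noteq> 0"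
      by (simp_all add: bs_map_scale)
    then show ?thesis
      using hpoint_eq_iff[OF bs_map_nonzero[OF nz] bs_map_nonzero[OF nz_abc]] by blast
  qed
  assume ?r
  then show ?l
    using *[of x' y' z'] *[of "invol x'" "invol y'" "invol z'"] nz' bs_map_invol by auto
qed

end

theory Submission
  imports Defs
begin

text \<open>For the coordinate tetrahedron the linear system has a basis of \<open>14\<close> monomials. An affine map
  carries their exponents bijectively to those of the invariant monomials of multidegree \<open>(2,2,2)\<close>.
  Hence both threefolds have the same points with nonzero coordinates, and every point in the image
  of either parametrization satisfies the binomial quadrics of this configuration of exponents.
  Conversely each nonzero solution of these quadrics is parametrized by \<open>\<P>\<^sup>1 \<times> \<P>\<^sup>1 \<times> \<P>\<^sup>1\<close>, so the
  Bayle-Sano threefold is closed, contains the rational image, and by density lies in its closure.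
  A linear change of coordinates and a change of basis reduce the general case to this one.\<close>

section \<open>Forms\<close>

definition monomial :: "('n::finite \<Rightarrow> nat) \<Rightarrow> complex ^ 'n \<Rightarrow> complex" where
  "monomial e x = (\<Prod>i\<in>UNIV. x $ i ^ e i)"

lemma monomial_add: "monomial (\<lambda>i. e i + e' i) x = monomial e x * monomial e' x"
  by (simp add: monomial_def power_add prod.distrib)

lemma monomial_mult_point: "monomial e (\<chi> i. x $ i * y $ i) = monomial e x * monomial e y"
  by (simp add: monomial_def power_mult_distrib prod.distrib)

lemma monomial_coordinate: "monomial (\<lambda>j. if j = i then 1 else 0) x = x $ i"
proof -
  have "monomial (\<lambda>j. if j = i then 1 else 0) x = (\<Prod>j\<in>UNIV. if j = i then x $ j else 1)"
    unfolding monomial_def by (intro prod.cong) auto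
  then show ?thesis by simp
qed

lemma monomial_split:
  assumes "e i > 0"
  shows "monomial e x = x $ i * monomial (e(i := e i - 1)) x"
proof -
  have "e = (\<lambda>j. (if j = i then 1 else 0) + (e(i := e i - 1)) j)"
    using assms by auto
  then have "monomial e x = monomial (\<lambda>j. (if j = i then 1 else 0) + (e(i := e i - 1)) j) x"
    by simp
  then show ?thesis
    by (simp only: monomial_add monomial_coordinate)
qed

text \<open>Monomials are multiplicative in the point, so this is Dedekind's independence of characters.\<close>

lemma monomials_independent:
  fixes m :: "'i \<Rightarrow> 'n::finite \<Rightarrow> nat"
  assumes "finite I" "inj_on m I" "\<And>x. (\<Sum>i\<in>I. c i * monomial (m i) x) = 0"
  shows "\<forall>i\<in>I. c i = 0"
  using assms
proof (induction I arbitrary: c rule: finite_induct)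
  case (insert a I)
  have c0: "c i = 0" if i: "i \<in> I" for i
  proof -
    have "m i \<noteq> m a" using insert.prems(1) insert.hyps i by (auto simp: inj_on_def)
    then obtain k where k: "m i k \<noteq> m a k" by auto
    \<comment> \<open>Doubling the single coordinate \<open>k\<close> separates the two characters:
      their values at \<open>u\<close> are \<open>2 ^ m i k\<close> and
      \<open>2 ^ m a k\<close>.\<close>
    define u :: "complex ^ 'n" where "u = (\<chi> j. if j = k then 2 else 1)"
    have u: "monomial e u = 2 ^ e k" for e
    proof -
      have "monomial e u = (\<Prod>j\<in>UNIV. if j = k then 2 ^ e j else 1)"
        unfolding monomial_def u_def by (intro prod.cong) auto
      then show ?thesis by simp
    qed
    \<comment> \<open>Subtracting \<open>monomial (m a) u\<close> times the relation at
      \<open>x\<close> from the relation at the coordinatewise product of \<open>u\<close> and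
      \<open>x\<close> cancels the term of \<open>a\<close>.\<close>
    have "(\<Sum>i\<in>I. (c i * (monomial (m i) u - monomial (m a) u)) * monomial (m i) x) = 0" for x
    proof -
      have "(\<Sum>i\<in>insert a I. c i * monomial (m i) (\<chi> j. u $ j * x $ j))
          - monomial (m a) u * (\<Sum>i\<in>insert a I. c i * monomial (m i) x) = 0"
        using insert.prems(2) by simp
      then show ?thesis
        using insert.hyps
        by (simp add: monomial_mult_point sum_distrib_left algebra_simps sum_subtractf)
    qed
    then have "c i * (monomial (m i) u - monomial (m a) u) = 0"
      using insert.IH[of "\<lambda>i. c i * (monomial (m i) u - monomial (m a) u)"] insert.prems(1) i
      by (auto simp: inj_on_insert)
    moreover have "(2::complex) ^ m i k \<noteq> 2 ^ m a k"
    proof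
      assume "(2::complex) ^ m i k = 2 ^ m a k"
      then have "norm ((2::complex) ^ m i k) = norm ((2::complex) ^ m a k)" by simp
      then have "(2::real) ^ m i k = 2 ^ m a k" by (simp add: norm_power)
      with k show False by simp
    qed
    ultimately show ?thesis by (simp add: u)
  qed
  have "c a = 0"
    using insert.prems(2)[of 1] insert.hyps c0 by (simp add: monomial_def)
  with c0 show ?case by auto
qed simp

lemma finite_exponents: "finite {e :: 'n::finite \<Rightarrow> nat. (\<Sum>i\<in>UNIV. e i) = d}"
proof (rule finite_subset)
  show "{e :: 'n \<Rightarrow> nat. (\<Sum>i\<in>UNIV. e i) = d} \<subseteq> Pi\<^sub>E UNIV (\<lambda>_. {..d})"
    by (auto intro: member_le_sum)
qed (auto intro: finite_PiE)

section \<open>Closure properties of forms\<close>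

lemma mem_forms_iff:
  "F \<in> forms d \<longleftrightarrow> (\<exists>c. F = (\<lambda>x. \<Sum>e | (\<Sum>i\<in>UNIV. e i) = d. c e * monomial e x))"
  by (simp add: forms_def monomial_def)

lemma forms_zero: "(\<lambda>x. 0) \<in> forms d"
  unfolding mem_forms_iff by (intro exI[of _ "\<lambda>_. 0"]) simp

lemma forms_add: "F \<in> forms d \<Longrightarrow> G \<in> forms d \<Longrightarrow> (\<lambda>x. F x + G x) \<in> forms d"
  unfolding mem_forms_iff
proof (elim exE)
  fix c c'
  assume "F = (\<lambda>x. \<Sum>e | (\<Sum>i\<in>UNIV. e i) = d. c e * monomial e x)"
    "G = (\<lambda>x. \<Sum>e | (\<Sum>i\<in>UNIV. e i) = d. c' e * monomial e x)"
  then show "\<exists>c. (\<lambda>x. F x + G x) = (\<lambda>x. \<Sum>e | (\<Sum>i\<in>UNIV. e i) = d. c e * monomial e x)"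
    by (intro exI[of _ "\<lambda>e. c e + c' e"]) (simp add: sum.distrib distrib_right)
qed

lemma forms_scale: "F \<in> forms d \<Longrightarrow> (\<lambda>x. k * F x) \<in> forms d"
  unfolding mem_forms_iff
proof (elim exE)
  fix c
  assume "F = (\<lambda>x. \<Sum>e | (\<Sum>i\<in>UNIV. e i) = d. c e * monomial e x)"
  then show "\<exists>c. (\<lambda>x. k * F x) = (\<lambda>x. \<Sum>e | (\<Sum>i\<in>UNIV. e i) = d. c e * monomial e x)"
    by (intro exI[of _ "\<lambda>e. k * c e"]) (simp add: sum_distrib_left mult.assoc)
qed

lemma forms_sum: "(\<And>i. i \<in> I \<Longrightarrow> F i \<in> forms d) \<Longrightarrow> (\<lambda>x. \<Sum>i\<in>I. F i x) \<in> forms d"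
  by (induction I rule: infinite_finite_induct) (simp_all add: forms_zero forms_add)

lemma monomial_in_forms: "monomial e \<in> forms (\<Sum>i\<in>UNIV. e i)"
  unfolding mem_forms_iff
proof (intro exI[of _ "\<lambda>e'. if e' = e then 1 else 0"] ext)
  fix x
  have "(\<Sum>e' | sum e' UNIV = sum e UNIV. (if e' = e then 1 else 0) * monomial e' x)
      = (\<Sum>e' | sum e' UNIV = sum e UNIV. if e' = e then monomial e' x else 0)"
    by (intro sum.cong) auto
  then show "monomial e x
      = (\<Sum>e' | sum e' UNIV = sum e UNIV. (if e' = e then 1 else 0) * monomial e' x)"
    by (simp add: sum.delta[OF finite_exponents])
qed

lemma forms_mult:
  assumes "F \<in> forms d" "G \<in> forms d'"
  shows "(\<lambda>x. F x * G x) \<in> forms (d + d')"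
proof -
  obtain c c' where F: "F = (\<lambda>x. \<Sum>e | (\<Sum>i\<in>UNIV. e i) = d. c e * monomial e x)"
    and G: "G = (\<lambda>x. \<Sum>e | (\<Sum>i\<in>UNIV. e i) = d'. c' e * monomial e x)"
    using assms unfolding mem_forms_iff by blast
  have eq: "(\<lambda>x. F x * G x) = (\<lambda>x. \<Sum>e | (\<Sum>i\<in>UNIV. e i) = d. \<Sum>e' | (\<Sum>i\<in>UNIV. e' i) = d'.
      (c e * c' e') * monomial (\<lambda>i. e i + e' i) x)"
    unfolding F G sum_product monomial_add by (intro ext sum.cong refl) (simp add: mult_ac)
  have "monomial (\<lambda>i. e i + e' i) \<in> forms (d + d')"
    if "(\<Sum>i\<in>UNIV. e i) = d" "(\<Sum>i\<in>UNIV. e' i) = d'" for e e'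
    using monomial_in_forms[of "\<lambda>i. e i + e' i"] that by (simp add: sum.distrib)
  then show ?thesis
    unfolding eq by (intro forms_sum forms_scale) auto
qed

lemma forms_one: "(\<lambda>x. 1) \<in> forms 0"
  using monomial_in_forms[of "\<lambda>_. 0"] by (simp add: monomial_def[abs_def])

lemma forms_coordinate: "(\<lambda>x. x $ i) \<in> forms 1"
  using monomial_in_forms[of "\<lambda>j. if j = i then 1 else 0"]
  by (simp add: monomial_coordinate[abs_def])

lemma forms_power: "F \<in> forms d \<Longrightarrow> (\<lambda>x. F x ^ n) \<in> forms (n * d)"
  by (induction n) (auto simp: forms_one dest: forms_mult)

lemma forms_prod:
  "finite I \<Longrightarrow> (\<And>i. i \<in> I \<Longrightarrow> F i \<in> forms (d i)) \<Longrightarrow> (\<lambda>x. \<Prod>i\<in>I. F i x) \<in> forms (\<Sum>i\<in>I. d i)"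
  by (induction I rule: finite_induct) (simp_all add: forms_one forms_mult)

lemma forms_compose_matrix:
  fixes A :: "complex ^ 'n ^ 'n"
  assumes "F \<in> forms d"
  shows "(\<lambda>x. F (A *v x)) \<in> forms d"
proof -
  obtain c where F: "F = (\<lambda>x. \<Sum>e | (\<Sum>i\<in>UNIV. e i) = d. c e * monomial e x)"
    using assms unfolding mem_forms_iff by blast
  have lin: "(\<lambda>x. (A *v x) $ i) \<in> forms 1" for i
    unfolding matrix_vector_mult_def
    by (simp, intro forms_sum forms_scale forms_coordinate[unfolded One_nat_def])
  have "(\<lambda>x. monomial e (A *v x)) \<in> forms (\<Sum>i\<in>UNIV. e i)" for e
    unfolding monomial_def
    using forms_prod[of UNIV "\<lambda>i x. (A *v x) $ i ^ e i" e] forms_power[OF lin] by simp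
  then show ?thesis
    unfolding F by (intro forms_sum forms_scale) auto
qed

lemma continuous_on_forms: "F \<in> forms d \<Longrightarrow> continuous_on S F"
  unfolding mem_forms_iff monomial_def by (auto intro!: continuous_intros)

section \<open>Projective transformations and closed sets\<close>

lemma image_hpoint: "(\<lambda>v. A *v v) ` hpoint w = hpoint (A *v w)" for A :: "complex ^ 'n ^ 'n"
  by (auto simp: hpoint_def vec.span_singleton image_image vector_scalar_commute)

lemma invertible_mult_nonzero:
  fixes A :: "complex ^ 'n ^ 'n"
  assumes "invertible A" "w \<noteq> 0"
  shows "A *v w \<noteq> 0"
  by (metis assms invertible_left_inverse matrix_vector_mul_assoc matrix_vector_mul_lid
      matrix_vector_mult_0_right)

text \<open>Composing the equations of \<open>Z\<close> with the inverse matrix gives forms of the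
  same degrees, and these cut out the image.\<close>

lemma zariski_closed_proj_transform:
  fixes A :: "complex ^ 'n ^ 'n"
  assumes "invertible A" "zariski_closed Z"
  shows "zariski_closed (proj_transform A Z)"
proof -
  obtain B where B: "A ** B = mat 1" "B ** A = mat 1"
    using assms(1) unfolding invertible_def by blast
  have inv: "invertible B" using B unfolding invertible_def by blast
  have [simp]: "A *v (B *v x) = x" "B *v (A *v x) = x" for x
    using B by (simp_all add: matrix_vector_mul_assoc)
  obtain \<F> where \<F>: "\<F> \<subseteq> (\<Union>d. forms d)" "Z = {L \<in> proj_space. \<forall>F\<in>\<F>. \<forall>v\<in>L. F v = 0}"
    using assms(2) unfolding zariski_closed_def by blast
  define \<G> where "\<G> = (\<lambda>F x. F (B *v x)) ` \<F>"
  have "\<G> \<subseteq> (\<Union>d. forms d)"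
    using \<F>(1) forms_compose_matrix unfolding \<G>_def by blast
  moreover have "proj_transform A Z = {L \<in> proj_space. \<forall>F\<in>\<G>. \<forall>v\<in>L. F v = 0}"
  proof (intro set_eqI iffI)
    fix L assume "L \<in> proj_transform A Z"
    then obtain M where M: "M \<in> Z" "L = (\<lambda>v. A *v v) ` M"
      unfolding proj_transform_def by blast
    then obtain w where "w \<noteq> 0" "M = hpoint w"
      unfolding \<F>(2) proj_space_def by blast
    with M have w: "w \<noteq> 0" "hpoint w \<in> Z" "L = hpoint (A *v w)"
      by (simp_all add: image_hpoint)
    have "F (B *v v) = 0" if "F \<in> \<F>" "v \<in> L" for F v
    proof -
      from that(2) obtain u where "u \<in> hpoint w" "v = A *v u"
        unfolding w(3) image_hpoint[symmetric] by blast
      with that(1) w(2) show ?thesis unfolding \<F>(2) by simp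
    qed
    then show "L \<in> {L \<in> proj_space. \<forall>F\<in>\<G>. \<forall>v\<in>L. F v = 0}"
      using w invertible_mult_nonzero[OF assms(1)] by (auto simp: proj_space_def \<G>_def)
  next
    fix L assume L: "L \<in> {L \<in> proj_space. \<forall>F\<in>\<G>. \<forall>v\<in>L. F v = 0}"
    then obtain w where w: "w \<noteq> 0" "L = hpoint w" unfolding proj_space_def by blast
    have "F u = 0" if "F \<in> \<F>" "u \<in> hpoint (B *v w)" for F u
    proof -
      from that(2) obtain v where "v \<in> L" "u = B *v v"
        unfolding w(2) image_hpoint[symmetric] by blast
      with L that(1) show ?thesis unfolding \<G>_def by auto
    qed
    then have "hpoint (B *v w) \<in> Z"
      unfolding \<F>(2) proj_space_def using invertible_mult_nonzero[OF inv w(1)] by auto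
    then show "L \<in> proj_transform A Z"
      unfolding proj_transform_def w(2) by (intro image_eqI) (auto simp: image_hpoint)
  qed
  ultimately show ?thesis unfolding zariski_closed_def by blast
qed

text \<open>Expanding each basis in the other gives square matrices \<open>A\<close> and
  \<open>B\<close>. Uniqueness of coefficients makes \<open>A ** B\<close> the identity, and for a
  square matrix a right inverse suffices.\<close>

lemma system_basis_change:
  fixes f g :: "'i::finite \<Rightarrow> 'a \<Rightarrow> complex"
  assumes f: "system_basis f V" and g: "system_basis g V"
  obtains A :: "complex ^ 'i ^ 'i"
  where "invertible A" "\<And>x. (\<chi> i. f i x) = A *v (\<chi> i. g i x)"
proof -
  have change: "\<exists>A :: complex ^ 'i ^ 'i. \<forall>x. (\<chi> i. f i x) = A *v (\<chi> i. g i x)"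
    if "system_basis f V" "system_basis g V" for f g :: "'i \<Rightarrow> 'a \<Rightarrow> complex"
  proof -
    have "\<forall>i. \<exists>c. f i = (\<lambda>x. \<Sum>j\<in>UNIV. c j * g j x)"
      using that unfolding system_basis_def by blast
    then obtain c where c: "\<And>i. f i = (\<lambda>x. \<Sum>j\<in>UNIV. c i j * g j x)" by metis
    show ?thesis
      by (intro exI[of _ "\<chi> i j. c i j"] allI, subst c) (simp add: matrix_vector_mult_def)
  qed
  obtain A :: "complex ^ 'i ^ 'i" where A: "\<And>x. (\<chi> i. f i x) = A *v (\<chi> i. g i x)"
    using change[OF f g] by blast
  obtain B :: "complex ^ 'i ^ 'i" where B: "\<And>x. (\<chi> i. g i x) = B *v (\<chi> i. f i x)"
    using change[OF g f] by blast
  have "(A ** B) $ i $ j = mat 1 $ i $ j" for i j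
  proof -
    have "(\<chi> i. f i x) = (A ** B) *v (\<chi> i. f i x)" for x
      using A[of x] B[of x] by (simp add: matrix_vector_mul_assoc)
    from arg_cong[OF this, of "\<lambda>v. v $ i"]
    have 1: "f i = (\<lambda>x. \<Sum>j\<in>UNIV. (A ** B) $ i $ j * f j x)"
      by (auto simp: matrix_vector_mult_def)
    have "(\<chi> i. f i x) = mat 1 *v (\<chi> i. f i x)" for x
      by simp
    from arg_cong[OF this, of "\<lambda>v. v $ i"]
    have 2: "f i = (\<lambda>x. \<Sum>j\<in>UNIV. mat 1 $ i $ j * f j x)"
      by (auto simp: matrix_vector_mult_def)
    have "\<exists>!c. f i = (\<lambda>x. \<Sum>j\<in>UNIV. c j * f j x)"
      using f unfolding system_basis_def by blast
    then have "(\<lambda>j. (A ** B) $ i $ j) = (\<lambda>j. mat 1 $ i $ j)"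
      using 1 2 by blast
    then show ?thesis by meson
  qed
  then have "A ** B = mat 1" by (simp add: vec_eq_iff)
  then have "invertible A" using invertible_right_inverse by blast
  with A that show thesis by blast
qed

section \<open>Sextics with double edges\<close>

lemma monomial_differentiable:
  obtains D where "(monomial e has_derivative D) (at p)"
proof -
  have "((\<lambda>x. x $ i) has_derivative (\<lambda>x. x $ i)) (at p)" for i
    by (intro bounded_linear_imp_has_derivative bounded_linear_vec_nth)
  then have "(\<lambda>x. x $ i) differentiable (at p)" for i
    unfolding differentiable_def by blast
  then have "\<exists>D. ((\<lambda>x. x $ i ^ e i) has_derivative D) (at p)" for i
    using differentiable_power[of "\<lambda>x. x $ i" p UNIV "e i"] unfolding differentiable_def by simp
  then obtain D where "\<And>i. ((\<lambda>x. x $ i ^ e i) has_derivative D i) (at p)" by metis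
  then show thesis
    using has_derivative_prod[of UNIV "\<lambda>i x. x $ i ^ e i" D p UNIV] that
    unfolding monomial_def[abs_def] by blast
qed

text \<open>Two factors that vanish at \<open>p\<close> split off, possibly the same coordinate
  twice, so the product rule leaves no term at \<open>p\<close>.\<close>

lemma double_point_monomial:
  assumes "k \<noteq> l" "e k + e l \<ge> 2" "p $ k = 0" "p $ l = 0"
  shows "double_point (monomial e) p"
proof -
  obtain a b e' where ab: "p $ a = 0" "p $ b = 0"
    and eq: "monomial e = (\<lambda>x. x $ a * (x $ b * monomial e' x))"
  proof -
    \<comment> \<open>Lowering the exponent of \<open>a\<close> before testing \<open>b\<close>
      covers the case \<open>a = b\<close>, which requires an exponent of at least 2.\<close>
    obtain a b where ab: "a \<in> {k, l}" "b \<in> {k, l}" "e a > 0" "(e(a := e a - 1)) b > 0"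
    proof -
      consider "e k \<ge> 2" | "e l \<ge> 2" | "e k = 1" "e l = 1" using assms(2) by linarith
      then show thesis
        by cases (use assms(1) that[of k k] that[of l l] that[of k l] in auto)
    qed
    show thesis
    proof (rule that)
      show "p $ a = 0" "p $ b = 0" using ab assms by auto
      show "monomial e = (\<lambda>x. x $ a * (x $ b
          * monomial ((e(a := e a - 1))(b := (e(a := e a - 1)) b - 1)) x))"
        using monomial_split[of e a, OF ab(3)] monomial_split[of "e(a := e a - 1)" b, OF ab(4)]
        by (intro ext) metis
    qed
  qed
  obtain D where D: "(monomial e' has_derivative D) (at p)"
    using monomial_differentiable by blast
  have c: "((\<lambda>x. x $ i) has_derivative (\<lambda>x. x $ i)) (at p)" for i
    by (intro bounded_linear_imp_has_derivative bounded_linear_vec_nth)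
  have "(monomial e has_derivative (\<lambda>_. 0)) (at p)"
    unfolding eq using has_derivative_mult[OF c[of a] has_derivative_mult[OF c[of b] D]] ab by simp
  moreover have "monomial e p = 0" using ab by (simp add: eq)
  ultimately show ?thesis unfolding double_point_def by blast
qed

lemma double_point_sum:
  assumes "\<And>i. i \<in> I \<Longrightarrow> double_point (F i) p"
  shows "double_point (\<lambda>x. \<Sum>i\<in>I. c i * F i x) p"
proof -
  have "((\<lambda>x. \<Sum>i\<in>I. c i * F i x) has_derivative (\<lambda>x. \<Sum>i\<in>I. c i * 0)) (at p)"
    using assms unfolding double_point_def
    by (intro has_derivative_sum has_derivative_mult_right) blast
  then show ?thesis using assms unfolding double_point_def by simp
qed

text \<open>On the curve that scales the coordinates \<open>k\<close> and \<open>l\<close> by \<open>t\<close>, the form becomes a polynomial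
  in \<open>t\<close>, and a double point at \<open>t = 0\<close> kills its coefficients of degree \<open>0\<close> and \<open>1\<close>.\<close>

lemma double_point_coefficients:
  fixes c :: "('n::finite \<Rightarrow> nat) \<Rightarrow> complex"
  assumes F: "F = (\<lambda>x. \<Sum>e | (\<Sum>i\<in>UNIV. e i) = d. c e * monomial e x)"
    and kl: "k \<noteq> l"
    and double: "\<And>p. p $ k = 0 \<Longrightarrow> p $ l = 0 \<Longrightarrow> double_point F p"
    and e: "(\<Sum>i\<in>UNIV. e i) = d" "e k + e l \<le> 1"
  shows "c e = 0"
proof -
  define E :: "('n \<Rightarrow> nat) set" where "E = {e. (\<Sum>i\<in>UNIV. e i) = d}"
  have fin: "finite E" unfolding E_def by (rule finite_exponents)
  have coeff: "(\<Sum>e\<in>{e\<in>E. e k + e l = 0}. c e * monomial e s) = 0"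
    "(\<Sum>e\<in>{e\<in>E. e k + e l = 1}. c e * monomial e s) = 0" for s
  proof -
    \<comment> \<open>The point \<open>a + t *s b\<close> is \<open>s\<close> at
      \<open>t = 1\<close> and lies on the locus of double points at \<open>t = 0\<close>.\<close>
    define a b where "a = (\<chi> i. if i = k \<or> i = l then 0 else s $ i)"
      and "b = (\<chi> i. if i = k \<or> i = l then s $ i else 0)"
    define \<gamma> where "\<gamma> = (\<lambda>t. a + t *s b)"
    have mon: "monomial e (\<gamma> t) = t ^ (e k + e l) * monomial e s" for e t
    proof -
      have "monomial e (\<gamma> t) = (\<Prod>i\<in>UNIV. (if i = k then t ^ e i else 1)
          * ((if i = l then t ^ e i else 1) * (s $ i ^ e i)))"
        unfolding monomial_def \<gamma>_def a_def b_def using kl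
        by (intro prod.cong) (auto simp: power_mult_distrib)
      then show ?thesis by (simp add: prod.distrib power_add monomial_def)
    qed
    have F\<gamma>: "F (\<gamma> t) = (\<Sum>e\<in>E. c e * monomial e s * t ^ (e k + e l))" for t
      unfolding F E_def by (simp add: mon mult_ac)
    have "double_point F (\<gamma> 0)"
      by (rule double) (simp_all add: \<gamma>_def a_def)
    then have D: "F (\<gamma> 0) = 0" "(F has_derivative (\<lambda>_. 0)) (at (\<gamma> 0))"
      unfolding double_point_def by blast+
    have "bounded_linear (\<lambda>t. t *s b)"
      unfolding linear_conv_bounded_linear[symmetric]
      by (rule linearI) (simp_all add: vec_eq_iff algebra_simps)
    then have "((\<lambda>t. a + t *s b) has_derivative (\<lambda>t. 0 + t *s b)) (at 0)"
      by (intro has_derivative_add has_derivative_const bounded_linear_imp_has_derivative)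
    then have "((\<lambda>t. F (\<gamma> t)) has_derivative (\<lambda>_. 0)) (at 0)"
      using has_derivative_compose[of "\<lambda>t. a + t *s b" "\<lambda>t. 0 + t *s b" 0 UNIV F "\<lambda>_. 0"] D(2)
      unfolding \<gamma>_def by blast
    moreover have "(*) 0 = (\<lambda>_ :: complex. 0 :: complex)" by auto
    ultimately have "((\<lambda>t. F (\<gamma> t)) has_field_derivative 0) (at 0)"
      unfolding has_field_derivative_def by metis
    moreover have "((\<lambda>t. F (\<gamma> t)) has_field_derivative
        (\<Sum>e\<in>E. c e * monomial e s * (of_nat (e k + e l) * 0 ^ (e k + e l - 1)))) (at 0)"
      unfolding F\<gamma>
    proof (intro DERIV_sum DERIV_cmult)
      fix e :: "'n \<Rightarrow> nat"
      show "((\<lambda>t. t ^ (e k + e l)) has_field_derivative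
          (of_nat (e k + e l) * 0 ^ (e k + e l - 1) :: complex)) (at 0)"
        by (rule DERIV_cong[OF DERIV_power[OF DERIV_ident]]) simp
    qed
    ultimately have "(\<Sum>e\<in>E. c e * monomial e s * (of_nat (e k + e l) * 0 ^ (e k + e l - 1))) = 0"
      using DERIV_unique by blast
    \<comment> \<open>Only exponent 1 contributes to the derivative at \<open>t = 0\<close>: for
      \<open>n = 0\<close> the factor \<open>of_nat n\<close> vanishes, although
      \<open>0 ^ (0 - 1)\<close> is 1.\<close>
    moreover have "of_nat n * 0 ^ (n - 1) = (if n = 1 then 1 else 0 :: complex)" for n
      by (cases n) auto
    moreover have "z * (if P then 1 else 0) = (if P then z else 0)" for z :: complex and P
      by simp
    ultimately show "(\<Sum>e\<in>{e\<in>E. e k + e l = 1}. c e * monomial e s) = 0"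
      by (simp only: sum.inter_filter[OF fin])
    have "(0::complex) ^ n = (if n = 0 then 1 else 0)" for n
      by simp
    moreover have "z * (if P then 1 else 0) = (if P then z else 0)" for z :: complex and P
      by simp
    ultimately show "(\<Sum>e\<in>{e\<in>E. e k + e l = 0}. c e * monomial e s) = 0"
      using D(1) unfolding F\<gamma> by (simp only: sum.inter_filter[OF fin])
  qed
  \<comment> \<open>Both sums vanish for every \<open>s\<close>, so independence of monomials
    applies to each weight separately.\<close>
  have "\<forall>e\<in>{e\<in>E. e k + e l = 0}. c e = 0"
    by (rule monomials_independent[where m = "\<lambda>e. e"]) (use fin coeff(1) in auto)
  moreover have "\<forall>e\<in>{e\<in>E. e k + e l = 1}. c e = 0"
    by (rule monomials_independent[where m = "\<lambda>e. e"]) (use fin coeff(2) in auto)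
  moreover have "e k + e l = 0 \<or> e k + e l = 1" using e(2) by linarith
  ultimately show ?thesis using e(1) unfolding E_def by auto
qed

section \<open>The linear system of the coordinate tetrahedron\<close>

lemma span_axis_pair:
  "vec.span {axis i (1::complex), axis j 1} = {p. \<forall>k. k \<noteq> i \<and> k \<noteq> j \<longrightarrow> p $ k = 0}"
proof (intro set_eqI iffI)
  fix p assume "p \<in> vec.span {axis i (1::complex), axis j 1}"
  then obtain a b where "p = a *s axis i 1 + b *s axis j 1"
    by (auto simp: vec.span_insert vec.span_singleton algebra_simps)
  then show "p \<in> {p. \<forall>k. k \<noteq> i \<and> k \<noteq> j \<longrightarrow> p $ k = 0}"
    by (simp add: axis_def)
next
  fix p assume p: "p \<in> {p :: complex ^ 'a. \<forall>k. k \<noteq> i \<and> k \<noteq> j \<longrightarrow> p $ k = 0}"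
  have "p = p $ i *s axis i 1 + (if i = j then 0 else p $ j) *s axis j 1"
    using p by (auto simp: vec_eq_iff axis_def)
  then show "p \<in> vec.span {axis i (1::complex), axis j 1}"
    by (metis insertI1 insertI2 vec.span_add vec.span_base vec.span_scale)
qed

text \<open>A monomial vanishes to order \<open>e k + e l\<close> along the edge where the
  coordinates \<open>k\<close> and \<open>l\<close> are zero. The solutions are the four exponents
  with entries 0, 2, 2, 2 and the ten obtained by adding 1 to every entry of a quadratic
  exponent.\<close>

definition double_edge_exponents :: "(4 \<Rightarrow> nat) set" where
  "double_edge_exponents = {e. (\<Sum>i\<in>UNIV. e i) = 6 \<and> (\<forall>k l. k \<noteq> l \<longrightarrow> e k + e l \<ge> 2)}"

text \<open>Passes between the two vertices that span an edge and the two coordinates that vanish on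
  it.\<close>

lemma complementary_pair:
  fixes i j :: 4
  assumes "i \<noteq> j"
  obtains k l where "k \<noteq> l" "\<And>n. n \<noteq> i \<and> n \<noteq> j \<longleftrightarrow> n = k \<or> n = l"
proof -
  have "card (UNIV - {i, j}) = 2"
    using assms by (simp add: card_Diff_subset)
  then obtain k l where "UNIV - {i, j} = {k, l}" "k \<noteq> l"
    unfolding card_2_iff by blast
  with that show thesis by blast
qed

text \<open>The conditions can be tested monomial by monomial:
  \<open>double_point_coefficients\<close> kills every other exponent, and the remaining monomials
  are double along each edge by \<open>double_point_monomial\<close>.\<close>

lemma double_edge_sextics_axis:
  "double_edge_sextics (\<lambda>i. axis i 1) =
    {F. \<exists>c. F = (\<lambda>x. \<Sum>e\<in>double_edge_exponents. c e * monomial e x)}"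
proof (intro set_eqI iffI)
  fix F assume "F \<in> double_edge_sextics (\<lambda>i. axis i 1)"
  then have "F \<in> forms 6"
    and F: "\<And>i j p. i \<noteq> j \<Longrightarrow> (\<forall>k. k \<noteq> i \<and> k \<noteq> j \<longrightarrow> p $ k = 0) \<Longrightarrow> double_point F p"
    unfolding double_edge_sextics_def span_axis_pair by blast+
  then obtain c where c: "F = (\<lambda>x. \<Sum>e | (\<Sum>i\<in>UNIV. e i) = 6. c e * monomial e x)"
    unfolding mem_forms_iff by blast
  have "c e = 0" if "(\<Sum>i\<in>UNIV. e i) = 6" "e \<notin> double_edge_exponents" for e
  proof -
    from that obtain k l where kl: "k \<noteq> l" "e k + e l \<le> 1"
      unfolding double_edge_exponents_def by (auto simp: not_le)
    obtain i j where ij: "i \<noteq> j" "\<And>n. n \<noteq> k \<and> n \<noteq> l \<longleftrightarrow> n = i \<or> n = j"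
      using complementary_pair[OF kl(1)] by blast
    have "double_point F p" if "p $ k = 0" "p $ l = 0" for p
      using F[OF ij(1), of p] ij(2) that by blast
    then show ?thesis
      using double_point_coefficients[OF c kl(1) _ that(1) kl(2)] by blast
  qed
  then have "F = (\<lambda>x. \<Sum>e\<in>double_edge_exponents. c e * monomial e x)"
    unfolding c by (intro ext sum.mono_neutral_right finite_exponents)
      (auto simp: double_edge_exponents_def)
  then show "F \<in> {F. \<exists>c. F = (\<lambda>x. \<Sum>e\<in>double_edge_exponents. c e * monomial e x)}" by blast
next
  fix F assume "F \<in> {F. \<exists>c. F = (\<lambda>x. \<Sum>e\<in>double_edge_exponents. c e * monomial e x)}"
  then obtain c where c: "F = (\<lambda>x. \<Sum>e\<in>double_edge_exponents. c e * monomial e x)" by blast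
  have "monomial e \<in> forms 6" if "e \<in> double_edge_exponents" for e
    using monomial_in_forms[of e] that unfolding double_edge_exponents_def by simp
  then have "F \<in> forms 6"
    unfolding c by (intro forms_sum forms_scale)
  moreover have "double_point F p"
    if ij: "i \<noteq> j" "p \<in> vec.span {axis i 1, axis j 1}" for i j p
  proof -
    obtain k l where kl: "k \<noteq> l" "\<And>n. n \<noteq> i \<and> n \<noteq> j \<longleftrightarrow> n = k \<or> n = l"
      using complementary_pair[OF ij(1)] by blast
    then have "p $ k = 0" "p $ l = 0"
      using ij(2) unfolding span_axis_pair by blast+
    then have "double_point (monomial e) p" if "e \<in> double_edge_exponents" for e
      using double_point_monomial[OF kl(1)] that unfolding double_edge_exponents_def
      using kl(1) by blast
    then show ?thesis unfolding c by (rule double_point_sum)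
  qed
  ultimately show "F \<in> double_edge_sextics (\<lambda>i. axis i 1)"
    unfolding double_edge_sextics_def by blast
qed

text \<open>\<open>P\<close> maps the edges of \<open>w\<close> onto those of \<open>v\<close>, and
  the chain rule pulls back a vanishing derivative. Applied to the inverse matrix, this also gives
  the converse.\<close>

lemma double_edge_sextics_compose:
  fixes P :: "complex ^ 4 ^ 4"
  assumes "F \<in> double_edge_sextics v" "\<And>i. P *v w i = v i"
  shows "(\<lambda>x. F (P *v x)) \<in> double_edge_sextics w"
proof -
  have F: "F \<in> forms 6" "\<And>i j p. i \<noteq> j \<Longrightarrow> p \<in> vec.span {v i, v j} \<Longrightarrow> double_point F p"
    using assms(1) unfolding double_edge_sextics_def by blast+
  have "double_point (\<lambda>x. F (P *v x)) p" if "i \<noteq> j" "p \<in> vec.span {w i, w j}" for i j p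
  proof -
    have "P *v p \<in> (\<lambda>x. P *v x) ` vec.span {w i, w j}" using that(2) by blast
    also have "\<dots> = vec.span ((\<lambda>x. P *v x) ` {w i, w j})"
      by (rule vec.linear_span_image[symmetric]) (rule matrix_vector_mul_linear_gen)
    finally have "double_point F (P *v p)" using F(2)[OF that(1)] assms(2) by simp
    moreover have "bounded_linear (\<lambda>x. P *v x)"
      unfolding linear_conv_bounded_linear[symmetric] by (rule linearI)
        (simp_all add: vec_eq_iff matrix_vector_mult_def
          scaleR_sum_right distrib_left sum.distrib)
    then have "((\<lambda>x. P *v x) has_derivative (\<lambda>x. P *v x)) (at p)"
      by (rule bounded_linear_imp_has_derivative)
    ultimately show ?thesis
      using has_derivative_compose[of "\<lambda>x. P *v x" "\<lambda>x. P *v x" p UNIV F "\<lambda>_. 0"]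
      unfolding double_point_def by blast
  qed
  with forms_compose_matrix[OF F(1)] show ?thesis
    unfolding double_edge_sextics_def by simp
qed

lemma tetrahedron_matrix:
  assumes "tetrahedron v"
  obtains P :: "complex ^ 4 ^ 4" where "invertible P" "\<And>i. P *v axis i 1 = v i"
proof -
  define P :: "complex ^ 4 ^ 4" where "P = (\<chi> r i. v i $ r)"
  have col: "column i P = v i" for i
    by (simp add: P_def column_def vec_eq_iff)
  have "\<forall>i. c i = 0" if "(\<Sum>i\<in>UNIV. c i *s column i P) = 0" for c
  proof -
    have inj: "inj v" and ind: "vec.independent (range v)"
      using assms unfolding tetrahedron_def by blast+
    \<comment> \<open>Independence concerns the set \<open>range v\<close>; injectivity turns the
      indexed relation into one over that set.\<close>
    have "(\<Sum>x\<in>range v. c (inv v x) *s x) = (\<Sum>i\<in>UNIV. c i *s v i)"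
      using inj by (simp add: sum.reindex)
    also have "\<dots> = 0" using that by (simp add: col)
    finally have "\<forall>x\<in>range v. c (inv v x) = 0"
      using vec.independentD[OF ind, of "range v" "\<lambda>x. c (inv v x)"] by simp
    then show ?thesis using inj by simp
  qed
  then have "invertible P"
    unfolding invertible_left_inverse matrix_left_invertible_independent_columns by blast
  moreover have "P *v axis i 1 = v i" for i
    by (simp add: P_def matrix_vector_mult_def axis_def vec_eq_iff if_distrib cong: if_cong)
  ultimately show thesis by (rule that)
qed

section \<open>The binomial equations of the Bayle-Sano threefold\<close>

lemma forall_14: "(\<forall>i::14. P i) \<longleftrightarrow> P 1 \<and> P 2 \<and> P 3 \<and> P 4 \<and> P 5 \<and> P 6 \<and> P 7 \<and> P 8 \<and> P 9
    \<and> P 10 \<and> P 11 \<and> P 12 \<and> P 13 \<and> P 14"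
proof -
  have "(\<forall>i. P i) \<longleftrightarrow> (\<forall>i\<in>UNIV. P i)" by blast
  then show ?thesis unfolding UNIV_14 by simp
qed

text \<open>The exponents of \<open>x\<^sub>1, y\<^sub>1, z\<^sub>1\<close> in the invariant monomials. These are the
  points with even coordinate sum of the cube \<open>{0, 1, 2}\<^sup>3\<close>, namely its vertices and the centres of
  its faces.\<close>

definition bs_exp :: "14 \<Rightarrow> nat ^ 3" where
  "bs_exp i = (vector
    [vector [0,0,0], vector [0,0,2], vector [0,1,1], vector [0,2,0], vector [0,2,2],
     vector [1,0,1], vector [1,1,0], vector [1,1,2], vector [1,2,1],
     vector [2,0,0], vector [2,0,2], vector [2,1,1], vector [2,2,0], vector [2,2,2]]
    :: nat ^ 3 ^ 14) $ i"

lemma bs_exp_nth: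
  "bs_exp 1 = vector [0,0,0]" "bs_exp 2 = vector [0,0,2]" "bs_exp 3 = vector [0,1,1]"
  "bs_exp 4 = vector [0,2,0]" "bs_exp 5 = vector [0,2,2]" "bs_exp 6 = vector [1,0,1]"
  "bs_exp 7 = vector [1,1,0]" "bs_exp 8 = vector [1,1,2]" "bs_exp 9 = vector [1,2,1]"
  "bs_exp 10 = vector [2,0,0]" "bs_exp 11 = vector [2,0,2]" "bs_exp 12 = vector [2,1,1]"
  "bs_exp 13 = vector [2,2,0]" "bs_exp 14 = vector [2,2,2]"
  by (simp_all add: bs_exp_def vector_def)

lemma bs_exp_le: "bs_exp i $ n \<le> 2"
proof -
  have "\<forall>i n. bs_exp i $ n \<le> 2"
    by (simp add: forall_14 forall_3 bs_exp_nth)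
  then show ?thesis by blast
qed

lemma bs_exp_even: "even (bs_exp i $ 1 + bs_exp i $ 2 + bs_exp i $ 3)"
proof -
  have "\<forall>i. even (bs_exp i $ 1 + bs_exp i $ 2 + bs_exp i $ 3)"
    by (simp add: forall_14 bs_exp_nth)
  then show ?thesis by blast
qed

lemma bs_exp_surj:
  assumes "\<And>n. u $ n \<le> 2" "even (u $ 1 + u $ 2 + u $ 3)"
  obtains i where "bs_exp i = u"
proof -
  have "u $ n = 0 \<or> u $ n = 1 \<or> u $ n = 2" for n
    using assms(1)[of n] by linarith
  \<comment> \<open>Of the 27 triples parity leaves 14, and each of them is an explicit value of
    \<open>bs_exp\<close>.\<close>
  from this[of 1] this[of 2] this[of 3] assms(2)
  have "\<not> (\<forall>i. bs_exp i \<noteq> u)"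
    unfolding forall_14 by (elim disjE) (simp_all add: bs_exp_nth vec_eq_iff forall_3)
  with that show thesis by blast
qed

lemma inj_bs_exp: "inj bs_exp"
proof (rule injI)
  have "\<forall>i j. bs_exp i = bs_exp j \<longrightarrow> i = j"
    unfolding forall_14 by (simp add: bs_exp_nth vec_eq_iff forall_3)
  then show "i = j" if "bs_exp i = bs_exp j" for i j using that by blast
qed

definition binary_monomial :: "complex ^ 2 \<Rightarrow> nat \<Rightarrow> complex" where
  "binary_monomial x a = x $ 1 ^ (2 - a) * x $ 2 ^ a"

text \<open>The product depends only on \<open>a + b\<close>, which is why additive relations
  between exponents become binomial equations. The bounds keep the subtractions exact.\<close>

lemma binary_monomial_mult:
  assumes "a \<le> 2" "b \<le> 2"
  shows "binary_monomial x a * binary_monomial x b = x $ 1 ^ (4 - (a + b)) * x $ 2 ^ (a + b)"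
proof -
  have "4 - (a + b) = (2 - a) + (2 - b)" using assms by simp
  then show ?thesis by (simp add: binary_monomial_def power_add)
qed

lemma binary_monomial_swap:
  "a \<le> 2 \<Longrightarrow> binary_monomial x (2 - a) = binary_monomial (vector [x $ 2, x $ 1]) a"
  by (simp add: binary_monomial_def)

lemma bs_map_eq_monomials:
  "bs_map x y z $ i = binary_monomial x (bs_exp i $ 1) * binary_monomial y (bs_exp i $ 2)
    * binary_monomial z (bs_exp i $ 3)"
proof -
  have "\<forall>i. bs_map x y z $ i = binary_monomial x (bs_exp i $ 1) * binary_monomial y (bs_exp i $ 2)
    * binary_monomial z (bs_exp i $ 3)"
    unfolding forall_14 by (simp add: bs_map_nth bs_exp_nth binary_monomial_def mult_ac)
  then show ?thesis by blast
qed

text \<open>The quadratic binomials of the toric variety of these fourteen lattice points, as a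
  condition on vectors; the zero vector satisfies it too.\<close>

definition toric :: "complex ^ 14 \<Rightarrow> bool" where
  "toric p \<longleftrightarrow>
    (\<forall>i j k l. bs_exp i + bs_exp j = bs_exp k + bs_exp l \<longrightarrow> p $ i * p $ j = p $ k * p $ l)"

lemma toricD: "toric p \<Longrightarrow> bs_exp i + bs_exp j = bs_exp k + bs_exp l \<Longrightarrow> p $ i * p $ j = p $ k * p $ l"
  unfolding toric_def by blast

lemma toric_scale_bs_map: "toric (c *s bs_map x y z)"
  unfolding toric_def
proof (intro allI impI)
  fix i j k l
  assume eq: "bs_exp i + bs_exp j = bs_exp k + bs_exp l"
  have "bs_map x y z $ i * bs_map x y z $ j =
      (binary_monomial x (bs_exp i $ 1) * binary_monomial x (bs_exp j $ 1)) *
      (binary_monomial y (bs_exp i $ 2) * binary_monomial y (bs_exp j $ 2)) *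
      (binary_monomial z (bs_exp i $ 3) * binary_monomial z (bs_exp j $ 3))" for i j
    unfolding bs_map_eq_monomials by (simp only: mult_ac)
  moreover have "bs_exp i $ n + bs_exp j $ n = bs_exp k $ n + bs_exp l $ n" for n
    using arg_cong[OF eq, of "\<lambda>u. u $ n"] by simp
  ultimately have "bs_map x y z $ i * bs_map x y z $ j = bs_map x y z $ k * bs_map x y z $ l"
    by (simp only: binary_monomial_mult[OF bs_exp_le bs_exp_le])
  then show "(c *s bs_map x y z) $ i * (c *s bs_map x y z) $ j
      = (c *s bs_map x y z) $ k * (c *s bs_map x y z) $ l"
    by simp
qed

text \<open>The variables are the entries of a symmetric \<open>3 \<times> 3\<close> matrix with diagonal \<open>a, b, c\<close>, and the
  assumptions are the vanishing of its \<open>2 \<times> 2\<close> minors.\<close>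

lemma symmetric_rank_one:
  fixes a b c d e f :: complex
  assumes "d * d = a * b" "e * e = a * c" "f * f = b * c" "d * e = a * f" "d * f = b * e"
    "e * f = c * d"
  obtains X Y Z where "a = X * X" "b = Y * Y" "c = Z * Z" "d = X * Y" "e = X * Z" "f = Y * Z"
proof (cases "a = 0")
  case False
  \<comment> \<open>A nonzero diagonal entry determines the vector up to sign: take its root, then
    divide the rest of its row by that root.\<close>
  define X where "X = csqrt a"
  have X: "a = X * X" "X \<noteq> 0"
    using False by (simp_all add: X_def flip: power2_eq_square)
  show thesis
    by (rule that[of X "d / X" "e / X"]) (use X assms in \<open>simp_all add: field_simps\<close>)
next
  case a: True
  \<comment> \<open>A zero diagonal entry makes its whole row vanish, which leaves the block of
    \<open>b\<close>, \<open>c\<close> and \<open>f\<close>.\<close>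
  then have de: "d = 0" "e = 0" using assms by auto
  show thesis
  proof (cases "b = 0")
    case False
    define Y where "Y = csqrt b"
    have Y: "b = Y * Y" "Y \<noteq> 0"
      using False by (simp_all add: Y_def flip: power2_eq_square)
    show thesis
      by (rule that[of 0 Y "f / Y"]) (use Y a de assms in \<open>simp_all add: field_simps\<close>)
  next
    case True
    show thesis
      by (rule that[of 0 0 "csqrt c"])
        (use True a de assms in \<open>simp_all flip: power2_eq_square\<close>)
  qed
qed

text \<open>After division by \<open>p $ 1\<close>, the coordinates 10, 4, 2 are the squares of
  affine parameters \<open>X\<close>, \<open>Y\<close>, \<open>Z\<close> and 7, 6, 3 their mixed
  products, by \<open>symmetric_rank_one\<close>. The relations containing \<open>p $ 1\<close> then
  determine the other seven coordinates.\<close>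

lemma toric_point_first_vertex:
  assumes p: "toric p" and p1: "p $ 1 \<noteq> 0"
  obtains k x y z where "x \<noteq> 0" "y \<noteq> 0" "z \<noteq> 0" "p = k *s bs_map x y z"
proof -
  have rel:
    "p $ 7 * p $ 7 = p $ 10 * p $ 4" "p $ 6 * p $ 6 = p $ 10 * p $ 2" "p $ 3 * p $ 3 = p $ 4 * p $ 2"
    "p $ 7 * p $ 6 = p $ 10 * p $ 3" "p $ 7 * p $ 3 = p $ 4 * p $ 6" "p $ 6 * p $ 3 = p $ 2 * p $ 7"
    "p $ 5 * p $ 1 = p $ 4 * p $ 2" "p $ 11 * p $ 1 = p $ 10 * p $ 2"
    "p $ 13 * p $ 1 = p $ 10 * p $ 4" "p $ 8 * p $ 1 = p $ 7 * p $ 2"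
    "p $ 9 * p $ 1 = p $ 6 * p $ 4" "p $ 12 * p $ 1 = p $ 3 * p $ 10"
    "p $ 14 * p $ 1 = p $ 13 * p $ 2"
    by (rule toricD[OF p]; simp add: bs_exp_nth vec_eq_iff forall_3)+
  obtain X Y Z where XYZ: "p $ 10 / p $ 1 = X * X" "p $ 4 / p $ 1 = Y * Y" "p $ 2 / p $ 1 = Z * Z"
    "p $ 7 / p $ 1 = X * Y" "p $ 6 / p $ 1 = X * Z" "p $ 3 / p $ 1 = Y * Z"
    by (rule symmetric_rank_one[of "p $ 7 / p $ 1" "p $ 10 / p $ 1" "p $ 4 / p $ 1"
          "p $ 6 / p $ 1" "p $ 2 / p $ 1" "p $ 3 / p $ 1"]) (use p1 rel in simp_all)
  then have base: "p $ 10 = p $ 1 * (X * X)" "p $ 4 = p $ 1 * (Y * Y)" "p $ 2 = p $ 1 * (Z * Z)"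
    "p $ 7 = p $ 1 * (X * Y)" "p $ 6 = p $ 1 * (X * Z)" "p $ 3 = p $ 1 * (Y * Z)"
    using p1 by (simp_all add: divide_eq_eq mult_ac)
  have cancel: "q = p $ 1 * (s * t)" if "q * p $ 1 = u * w" "u = p $ 1 * s" "w = p $ 1 * t"
    for q s t u w
    using that p1 by (simp add: mult_ac)
  note more = cancel[OF rel(7) base(2,3)] cancel[OF rel(8) base(1,3)] cancel[OF rel(9) base(1,2)]
    cancel[OF rel(10) base(4,3)] cancel[OF rel(11) base(5,2)] cancel[OF rel(12) base(6,1)]
    cancel[OF rel(13) cancel[OF rel(9) base(1,2)] base(3)]
  define x y z :: "complex ^ 2" where "x = vector [1, X]" and "y = vector [1, Y]" and "z = vector [1, Z]"
  have "p = p $ 1 *s bs_map x y z"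
    unfolding vec_eq_iff forall_14 vector_smult_component bs_map_nth x_def y_def z_def vector_2
    by (intro conjI; (simp; fail)?;
        (subst base more, simp add: power2_eq_square mult_ac; fail)?)
  moreover have "x \<noteq> 0" "y \<noteq> 0" "z \<noteq> 0"
    by (simp_all add: vec2_nonzero_iff x_def y_def z_def)
  ultimately show thesis using that by blast
qed

text \<open>The reflections \<open>a \<mapsto> 2 - a\<close> of the cube move a vertex with nonzero coordinate to the origin,
  and on the side of the parameters they exchange the two homogeneous coordinates.\<close>

lemma toric_point:
  assumes p: "toric p" and nz: "p \<noteq> 0"
  obtains k x y z where "x \<noteq> 0" "y \<noteq> 0" "z \<noteq> 0" "p = k *s bs_map x y z"
proof -
  \<comment> \<open>Each face centre is the midpoint of two opposite vertices of its face, so the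
    square of its coordinate is a product of two vertex coordinates. Hence a nonzero point has a
    nonzero vertex coordinate.\<close>
  have rel: "p $ 3 * p $ 3 = p $ 1 * p $ 5" "p $ 6 * p $ 6 = p $ 1 * p $ 11"
    "p $ 7 * p $ 7 = p $ 1 * p $ 13" "p $ 8 * p $ 8 = p $ 2 * p $ 14"
    "p $ 9 * p $ 9 = p $ 4 * p $ 14" "p $ 12 * p $ 12 = p $ 10 * p $ 14"
    by (rule toricD[OF p]; simp add: bs_exp_nth vec_eq_iff forall_3)+
  have "\<not> (\<forall>i. p $ i \<noteq> 0 \<longrightarrow> \<not> (\<forall>n. bs_exp i $ n = 0 \<or> bs_exp i $ n = 2))"
  proof
    assume "\<forall>i. p $ i \<noteq> 0 \<longrightarrow> \<not> (\<forall>n. bs_exp i $ n = 0 \<or> bs_exp i $ n = 2)"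
    then have "p $ 1 = 0" "p $ 2 = 0" "p $ 4 = 0" "p $ 5 = 0" "p $ 10 = 0" "p $ 11 = 0"
      "p $ 13 = 0" "p $ 14 = 0"
      unfolding forall_14 by (simp_all add: forall_3 bs_exp_nth)
    with rel have "\<forall>i. p $ i = 0" unfolding forall_14 by simp
    with nz show False by (simp add: vec_eq_iff)
  qed
  then obtain v where v: "p $ v \<noteq> 0" "\<And>n. bs_exp v $ n = 0 \<or> bs_exp v $ n = 2" by blast
  define flip :: "3 \<Rightarrow> nat \<Rightarrow> nat" where "flip = (\<lambda>n a. if bs_exp v $ n = 0 then a else 2 - a)"
  \<comment> \<open>Reflecting by \<open>2 - a\<close> preserves the cube and all parities, so it
    permutes the fourteen points.\<close>
  have "\<exists>j. \<forall>n. bs_exp j $ n = flip n (bs_exp i $ n)" for i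
  proof -
    define u :: "nat ^ 3" where "u = (\<chi> n. flip n (bs_exp i $ n))"
    have "u $ n \<le> 2" for n
      using bs_exp_le[of i n] by (simp add: u_def flip_def)
    moreover have "even (u $ n) \<longleftrightarrow> even (bs_exp i $ n)" for n
      using bs_exp_le[of i n] by (simp add: u_def flip_def)
    then have "even (u $ 1 + u $ 2 + u $ 3)"
      using bs_exp_even[of i] by simp
    ultimately obtain j where "bs_exp j = u" using bs_exp_surj by blast
    then show ?thesis by (intro exI[of _ j]) (simp add: u_def)
  qed
  then obtain \<pi> where \<pi>: "\<And>i n. bs_exp (\<pi> i) $ n = flip n (bs_exp i $ n)" by metis
  have \<pi>\<pi>: "\<pi> (\<pi> i) = i" for i
  proof -
    have "bs_exp (\<pi> (\<pi> i)) = bs_exp i"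
      using bs_exp_le[of i] by (simp add: vec_eq_iff \<pi>) (simp add: flip_def)
    then show ?thesis using inj_bs_exp by (simp add: inj_eq)
  qed
  have \<pi>1: "\<pi> 1 = v"
  proof -
    have "\<forall>n. bs_exp 1 $ n = 0" by (simp add: bs_exp_nth forall_3)
    then have "bs_exp (\<pi> 1) = bs_exp v"
      using v(2) unfolding vec_eq_iff \<pi> flip_def by (metis diff_zero)
    then show ?thesis using inj_bs_exp by (simp add: inj_eq)
  qed
  define q where "q = (\<chi> i. p $ \<pi> i)"
  have "toric q"
    unfolding toric_def
  proof (intro allI impI)
    fix i j k l
    assume eq: "bs_exp i + bs_exp j = bs_exp k + bs_exp l"
    \<comment> \<open>Reflections are affine and both sides have two terms, so the constants
      cancel.\<close>
    have "bs_exp (\<pi> i) $ n + bs_exp (\<pi> j) $ n = bs_exp (\<pi> k) $ n + bs_exp (\<pi> l) $ n" for n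
      using arg_cong[OF eq, of "\<lambda>u. u $ n"] bs_exp_le[of i n] bs_exp_le[of j n] bs_exp_le[of k n]
        bs_exp_le[of l n]
      by (simp add: \<pi> flip_def) arith
    then have "bs_exp (\<pi> i) + bs_exp (\<pi> j) = bs_exp (\<pi> k) + bs_exp (\<pi> l)"
      by (simp add: vec_eq_iff)
    from toricD[OF p this] show "q $ i * q $ j = q $ k * q $ l"
      by (simp add: q_def)
  qed
  moreover have "q $ 1 \<noteq> 0" using v(1) by (simp add: q_def \<pi>1)
  ultimately obtain k x y z where nz: "x \<noteq> 0" "y \<noteq> 0" "z \<noteq> 0" and q: "q = k *s bs_map x y z"
    by (rule toric_point_first_vertex)
  define f where "f = (\<lambda>n (x :: complex ^ 2). if bs_exp v $ n = 0 then x else vector [x $ 2, x $ 1])"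
  have flip: "binary_monomial x (flip n (bs_exp i $ n)) = binary_monomial (f n x) (bs_exp i $ n)"
    for x n i
    by (simp add: flip_def f_def binary_monomial_swap[OF bs_exp_le])
  have "p $ i = (k *s bs_map (f 1 x) (f 2 y) (f 3 z)) $ i" for i
  proof -
    have "p $ i = q $ \<pi> i" by (simp add: q_def \<pi>\<pi>)
    then show ?thesis by (simp add: q bs_map_eq_monomials \<pi> flip)
  qed
  then have "p = k *s bs_map (f 1 x) (f 2 y) (f 3 z)" by (simp add: vec_eq_iff)
  moreover have "f n x \<noteq> 0" if "x \<noteq> 0" for n x
    using that by (auto simp: f_def vec2_nonzero_iff)
  ultimately show thesis using that nz by blast
qed

section \<open>Closedness of the Bayle-Sano threefold and density of its points with nonzero
  parameters\<close>

lemma hpoint_in_W_BS_iff: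
  assumes "p \<noteq> 0"
  shows "hpoint p \<in> W_BS \<longleftrightarrow> toric p"
proof
  assume "hpoint p \<in> W_BS"
  then obtain x y z where xyz: "x \<noteq> 0" "y \<noteq> 0" "z \<noteq> 0" "hpoint p = hpoint (bs_map x y z)"
    unfolding W_BS_def by blast
  then obtain c where "p = c *s bs_map x y z"
    using hpoint_eq_iff[OF assms bs_map_nonzero] by blast
  then show "toric p" by (simp add: toric_scale_bs_map)
next
  assume "toric p"
  then obtain k x y z where xyz: "x \<noteq> 0" "y \<noteq> 0" "z \<noteq> 0" and p: "p = k *s bs_map x y z"
    using assms by (rule toric_point)
  have "k \<noteq> 0" using p assms by auto
  then have "hpoint p = hpoint (bs_map x y z)"
    using hpoint_eq_iff[OF assms bs_map_nonzero[OF xyz]] p by blast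
  then show "hpoint p \<in> W_BS" unfolding W_BS_def using xyz by blast
qed

lemma zariski_closed_W_BS: "zariski_closed W_BS"
proof -
  define \<F> :: "(complex ^ 14 \<Rightarrow> complex) set"
    where "\<F> = (\<lambda>(i, j, k, l) p. p $ i * p $ j + (-1) * (p $ k * p $ l)) `
      {(i, j, k, l). bs_exp i + bs_exp j = bs_exp k + bs_exp l}"
  have "\<F> \<subseteq> forms (1 + 1)"
    unfolding \<F>_def
    by (intro image_subsetI, simp only: split_paired_all prod.case)
      (intro forms_add forms_scale forms_mult forms_coordinate)
  then have "\<F> \<subseteq> (\<Union>d. forms d)" by blast
  moreover have "(\<forall>F\<in>\<F>. F p = 0) \<longleftrightarrow> toric p" for p
    by (simp add: \<F>_def toric_def)
  then have "(\<forall>F\<in>\<F>. \<forall>v\<in>L. F v = 0) \<longleftrightarrow> (\<forall>v\<in>L. toric v)" for L by blast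
  moreover have "W_BS = {L \<in> proj_space. \<forall>v\<in>L. toric v}"
  proof (intro set_eqI iffI)
    fix L assume "L \<in> W_BS"
    then obtain x y z where xyz: "x \<noteq> 0" "y \<noteq> 0" "z \<noteq> 0" and L: "L = hpoint (bs_map x y z)"
      unfolding W_BS_def by blast
    have "\<forall>v\<in>L. toric v"
      unfolding L hpoint_def vec.span_singleton using toric_scale_bs_map by blast
    then show "L \<in> {L \<in> proj_space. \<forall>v\<in>L. toric v}"
      using bs_map_nonzero[OF xyz] unfolding proj_space_def L by blast
  next
    fix L assume L: "L \<in> {L \<in> proj_space. \<forall>v\<in>L. toric v}"
    then obtain p where p: "p \<noteq> 0" "L = hpoint p" unfolding proj_space_def by blast
    have "p \<in> hpoint p" unfolding hpoint_def by (rule vec.span_base) simp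
    with L p show "L \<in> W_BS" by (simp add: hpoint_in_W_BS_iff)
  qed
  ultimately show ?thesis unfolding zariski_closed_def by (intro exI[of _ \<F>]) simp
qed

text \<open>Polynomial identities extend from points with nonzero coordinates by perturbing the
  vanishing coordinates.\<close>

lemma bs_map_density:
  fixes G :: "complex ^ 14 \<Rightarrow> complex"
  assumes cont: "continuous_on UNIV G"
    and zero: "\<And>x y z. (\<forall>i. x $ i \<noteq> 0 \<and> y $ i \<noteq> 0 \<and> z $ i \<noteq> 0) \<Longrightarrow> G (bs_map x y z) = 0"
  shows "G (bs_map x y z) = 0"
proof -
  \<comment> \<open>Only the vanishing coordinates become \<open>t\<close>, so for
    \<open>t \<noteq> 0\<close> none is zero, and the limit at 0 is the original point.\<close>
  define f where "f = (\<lambda>(x :: complex ^ 2) t. \<chi> i. if x $ i = 0 then t else x $ i)"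
  have lim: "((\<lambda>t. f x t $ i) \<longlongrightarrow> x $ i) (at 0)" for x i
    by (cases "x $ i = 0") (simp_all add: f_def)
  have "((\<lambda>t. binary_monomial (f x t) a) \<longlongrightarrow> binary_monomial x a) (at 0)" for x a
    unfolding binary_monomial_def by (intro tendsto_intros lim)
  then have "((\<lambda>t. bs_map (f x t) (f y t) (f z t)) \<longlongrightarrow> bs_map x y z) (at 0)"
    by (intro vec_tendstoI, unfold bs_map_eq_monomials) (intro tendsto_intros)
  then have "((\<lambda>t. G (bs_map (f x t) (f y t) (f z t))) \<longlongrightarrow> G (bs_map x y z)) (at 0)"
    by (intro continuous_on_tendsto_compose[OF cont]) auto
  moreover have "G (bs_map (f x t) (f y t) (f z t)) = 0" if "t \<noteq> 0" for t
    by (rule zero) (use that in \<open>simp add: f_def\<close>)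
  then have "((\<lambda>t. G (bs_map (f x t) (f y t) (f z t))) \<longlongrightarrow> 0) (at 0)"
    by (intro tendsto_eventually) (auto simp: eventually_at_filter)
  ultimately show ?thesis
    using tendsto_unique[OF at_neq_bot] by blast
qed

section \<open>Comparison of the two systems of monomials\<close>

text \<open>The affine bijection between the two sets of exponents which is induced by the substitution
  \<open>s = (x\<^sub>1 y\<^sub>1 z\<^sub>1, x\<^sub>0 y\<^sub>0 z\<^sub>1, x\<^sub>0 y\<^sub>1 z\<^sub>0, x\<^sub>1 y\<^sub>0 z\<^sub>0)\<close>, up to the common factor
  \<open>(x\<^sub>0 x\<^sub>1 y\<^sub>0 y\<^sub>1 z\<^sub>0 z\<^sub>1)\<^sup>2\<close>. No subtraction truncates, by \<open>sextic_exp_eqs\<close>.\<close>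

definition sextic_exp :: "14 \<Rightarrow> 4 \<Rightarrow> nat" where
  "sextic_exp i n = (let u = bs_exp i; h = (u $ 1 + u $ 2 + u $ 3) div 2 in
    if n = 1 then h else if n = 2 then 2 + u $ 3 - h else if n = 3 then 2 + u $ 2 - h
    else 2 + u $ 1 - h)"

text \<open>Parity makes the halving exact. The coordinate sum is at most 4 plus any one coordinate,
  so its half never exceeds 2 plus that coordinate. In this additive form linear arithmetic can use
  the definition.\<close>

lemma sextic_exp_eqs:
  "2 * sextic_exp i 1 = bs_exp i $ 1 + bs_exp i $ 2 + bs_exp i $ 3"
  "sextic_exp i 1 + sextic_exp i 4 = 2 + bs_exp i $ 1"
  "sextic_exp i 1 + sextic_exp i 3 = 2 + bs_exp i $ 2"
  "sextic_exp i 1 + sextic_exp i 2 = 2 + bs_exp i $ 3"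
proof -
  obtain h where h: "bs_exp i $ 1 + bs_exp i $ 2 + bs_exp i $ 3 = 2 * h"
    using bs_exp_even[of i] by (rule evenE)
  then show "2 * sextic_exp i 1 = bs_exp i $ 1 + bs_exp i $ 2 + bs_exp i $ 3"
    "sextic_exp i 1 + sextic_exp i 4 = 2 + bs_exp i $ 1"
    "sextic_exp i 1 + sextic_exp i 3 = 2 + bs_exp i $ 2"
    "sextic_exp i 1 + sextic_exp i 2 = 2 + bs_exp i $ 3"
    using bs_exp_le[of i 1] bs_exp_le[of i 2] bs_exp_le[of i 3] h
    by (simp_all add: sextic_exp_def Let_def)
qed

lemma inj_sextic_exp: "inj sextic_exp"
proof (rule injI)
  fix i j assume "sextic_exp i = sextic_exp j"
  then have "bs_exp i = bs_exp j"
    using sextic_exp_eqs[of i] sextic_exp_eqs[of j] by (simp add: vec_eq_iff forall_3)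
  then show "i = j" using inj_bs_exp by (simp add: inj_eq)
qed

text \<open>The six pair conditions are the six faces of the cube: pairs containing index 1 say that
  a coordinate is at least 0, and the complementary pairs, by total degree 6, that it is at most
  2.\<close>

lemma range_sextic_exp: "range sextic_exp = double_edge_exponents"
proof (intro set_eqI iffI)
  fix e assume "e \<in> range sextic_exp"
  then obtain i where e: "e = sextic_exp i" by blast
  have "(\<Sum>n\<in>UNIV. e n) = 6"
    using sextic_exp_eqs[of i] by (simp add: sum_4 e)
  moreover have "\<forall>k l. k \<noteq> l \<longrightarrow> e k + e l \<ge> 2"
    using sextic_exp_eqs[of i] bs_exp_le[of i 1] bs_exp_le[of i 2] bs_exp_le[of i 3]
    unfolding forall_4 e by simp
  ultimately show "e \<in> double_edge_exponents" unfolding double_edge_exponents_def by blast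
next
  fix e assume "e \<in> double_edge_exponents"
  then have sum: "e 1 + e 2 + e 3 + e 4 = 6" and pairs: "\<forall>k l. k \<noteq> l \<longrightarrow> e k + e l \<ge> 2"
    unfolding double_edge_exponents_def by (simp_all add: sum_4)
  have p: "e 1 + e 2 \<ge> 2" "e 1 + e 3 \<ge> 2" "e 1 + e 4 \<ge> 2" "e 2 + e 3 \<ge> 2" "e 2 + e 4 \<ge> 2"
    "e 3 + e 4 \<ge> 2"
    using pairs by simp_all
  define u :: "nat ^ 3" where "u = vector [e 1 + e 4 - 2, e 1 + e 3 - 2, e 1 + e 2 - 2]"
  have "\<forall>n. u $ n \<le> 2"
    using sum p unfolding forall_3 u_def vector_3 by linarith
  moreover have "u $ 1 + u $ 2 + u $ 3 = 2 * e 1"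
    using sum p by (simp add: u_def)
  then have "even (u $ 1 + u $ 2 + u $ 3)" by simp
  ultimately obtain i where i: "bs_exp i = u" using bs_exp_surj by metis
  have "\<forall>n. sextic_exp i n = e n"
    using sextic_exp_eqs[of i] sum p unfolding i u_def vector_3 forall_4
    by (intro conjI; linarith)
  then show "e \<in> range sextic_exp" by (intro image_eqI[of _ _ i]) auto
qed

definition sextic_map :: "complex ^ 4 \<Rightarrow> complex ^ 14" where
  "sextic_map s = (\<chi> i. monomial (sextic_exp i) s)"

text \<open>The map from \<open>bs_exp i\<close> to \<open>sextic_exp i\<close> is affine, so it
  preserves equalities between sums of two exponents.\<close>

lemma toric_sextic_map: "toric (sextic_map s)"
  unfolding toric_def
proof (intro allI impI)
  fix i j k l
  assume eq: "bs_exp i + bs_exp j = bs_exp k + bs_exp l"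
  have "bs_exp i $ n + bs_exp j $ n = bs_exp k $ n + bs_exp l $ n" for n
    using arg_cong[OF eq, of "\<lambda>u. u $ n"] by simp
  note sums = this[of 1] this[of 2] this[of 3]
  note eqs = sextic_exp_eqs[of i] sextic_exp_eqs[of j] sextic_exp_eqs[of k] sextic_exp_eqs[of l]
  have first: "sextic_exp i 1 + sextic_exp j 1 = sextic_exp k 1 + sextic_exp l 1"
    using sums eqs(1,5,9,13) by linarith
  have "sextic_exp i 2 + sextic_exp j 2 = sextic_exp k 2 + sextic_exp l 2"
    using first sums(3) eqs(4,8,12,16) by linarith
  moreover have "sextic_exp i 3 + sextic_exp j 3 = sextic_exp k 3 + sextic_exp l 3"
    using first sums(2) eqs(3,7,11,15) by linarith
  moreover have "sextic_exp i 4 + sextic_exp j 4 = sextic_exp k 4 + sextic_exp l 4"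
    using first sums(1) eqs(2,6,10,14) by linarith
  ultimately have "\<forall>n. sextic_exp i n + sextic_exp j n = sextic_exp k n + sextic_exp l n"
    using first unfolding forall_4 by blast
  then show "sextic_map s $ i * sextic_map s $ j = sextic_map s $ k * sextic_map s $ l"
    by (simp add: sextic_map_def flip: monomial_add)
qed

text \<open>Each coordinate of \<open>x\<close>, \<open>y\<close>, \<open>z\<close> occurs in
  exactly two of the four products, so its exponent is a pair sum of \<open>sextic_exp i\<close>.
  The surplus 2 in every pair sum produces the common square.\<close>

lemma sextic_map_eq_bs_map:
  "sextic_map (vector [x $ 2 * y $ 2 * z $ 2, x $ 1 * y $ 1 * z $ 2, x $ 1 * y $ 2 * z $ 1,
      x $ 2 * y $ 1 * z $ 1])
    = ((x $ 1 * x $ 2 * y $ 1 * y $ 2 * z $ 1 * z $ 2)^2) *s bs_map x y z"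
proof -
  have "sextic_map (vector [x $ 2 * y $ 2 * z $ 2, x $ 1 * y $ 1 * z $ 2, x $ 1 * y $ 2 * z $ 1,
      x $ 2 * y $ 1 * z $ 1]) $ i
    = (x $ 1 * x $ 2 * y $ 1 * y $ 2 * z $ 1 * z $ 2)^2 * bs_map x y z $ i" for i
  proof -
    define a where "a = bs_exp i"
    define e where "e = sextic_exp i"
    have eq: "e 1 + e 4 = 2 + a $ 1" "e 1 + e 3 = 2 + a $ 2" "e 1 + e 2 = 2 + a $ 3"
      "e 2 + e 3 = 2 + (2 - a $ 1)" "e 2 + e 4 = 2 + (2 - a $ 2)" "e 3 + e 4 = 2 + (2 - a $ 3)"
      using sextic_exp_eqs[of i] bs_exp_le[of i 1] bs_exp_le[of i 2] bs_exp_le[of i 3]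
      unfolding a_def e_def by linarith+
    have "monomial e (vector [x $ 2 * y $ 2 * z $ 2, x $ 1 * y $ 1 * z $ 2, x $ 1 * y $ 2 * z $ 1,
        x $ 2 * y $ 1 * z $ 1])
      = x $ 1 ^ (e 2 + e 3) * x $ 2 ^ (e 1 + e 4) * (y $ 1 ^ (e 2 + e 4) * y $ 2 ^ (e 1 + e 3))
        * (z $ 1 ^ (e 3 + e 4) * z $ 2 ^ (e 1 + e 2))"
      unfolding monomial_def UNIV_4
      by (simp add: vector_def power_mult_distrib power_add mult_ac)
    also have "\<dots> = (x $ 1 * x $ 2 * y $ 1 * y $ 2 * z $ 1 * z $ 2)^2 * bs_map x y z $ i"
      unfolding eq bs_map_eq_monomials binary_monomial_def a_def[symmetric]
      by (simp only: power_add power_mult_distrib mult_ac)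
    finally show ?thesis by (simp add: sextic_map_def e_def)
  qed
  then show ?thesis by (simp add: vec_eq_iff)
qed

text \<open>Spanning comes from \<open>double_edge_sextics_axis\<close>, reindexed along the
  bijection of exponents; uniqueness comes from the independence of monomials.\<close>

lemma system_basis_sextics_axis:
  "system_basis (\<lambda>i. monomial (sextic_exp i)) (double_edge_sextics (\<lambda>i. axis i 1))"
proof -
  have sum: "(\<Sum>e\<in>double_edge_exponents. c e * monomial e x)
      = (\<Sum>i\<in>UNIV. c (sextic_exp i) * monomial (sextic_exp i) x)" for c x
    unfolding range_sextic_exp[symmetric] by (simp add: sum.reindex[OF inj_sextic_exp])
  have "monomial (sextic_exp i) \<in> double_edge_sextics (\<lambda>i. axis i 1)" for i
  proof -
    define c where "c = (\<lambda>e. if e = sextic_exp i then 1 else 0 :: complex)"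
    have "c (sextic_exp j) * z = (if j = i then z else 0)" for j z
      by (simp add: c_def inj_eq[OF inj_sextic_exp])
    then have "monomial (sextic_exp i) = (\<lambda>x. \<Sum>e\<in>double_edge_exponents. c e * monomial e x)"
      unfolding sum by simp
    then show ?thesis unfolding double_edge_sextics_axis by blast
  qed
  moreover have "\<exists>!c. F = (\<lambda>x. \<Sum>i\<in>UNIV. c i * monomial (sextic_exp i) x)"
    if F: "F \<in> double_edge_sextics (\<lambda>i. axis i 1)" for F
  proof -
    obtain c where "F = (\<lambda>x. \<Sum>e\<in>double_edge_exponents. c e * monomial e x)"
      using F unfolding double_edge_sextics_axis by blast
    then have "F = (\<lambda>x. \<Sum>i\<in>UNIV. (c (sextic_exp i)) * monomial (sextic_exp i) x)"
      unfolding sum .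
    moreover have "b = b'"
      if "F = (\<lambda>x. \<Sum>i\<in>UNIV. b i * monomial (sextic_exp i) x)"
        "F = (\<lambda>x. \<Sum>i\<in>UNIV. b' i * monomial (sextic_exp i) x)" for b b'
    proof -
      have "(\<Sum>i\<in>UNIV. (b i - b' i) * monomial (sextic_exp i) x) = 0" for x
        using fun_cong[OF that(1), of x] fun_cong[OF that(2), of x]
        by (simp add: left_diff_distrib sum_subtractf)
      then have "\<forall>i\<in>UNIV. b i - b' i = 0"
        by (intro monomials_independent[OF finite inj_sextic_exp])
      then show ?thesis by auto
    qed
    ultimately show ?thesis by (intro ex1I[of _ "\<lambda>i. c (sextic_exp i)"])
  qed
  ultimately show ?thesis unfolding system_basis_def by blast
qed

section \<open>Transport to a general tetrahedron and the closure of the rational image\<close>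

lemma system_basis_compose:
  assumes basis: "system_basis f V"
    and inverse: "\<And>x. p (q x) = x" "\<And>x. q (p x) = x"
    and U: "\<And>F. F \<in> U \<longleftrightarrow> (\<lambda>x. F (p x)) \<in> V"
  shows "system_basis (\<lambda>i x. f i (q x)) U"
proof -
  have "(\<lambda>x. f i (q x)) \<in> U" for i
    using basis unfolding U inverse(2) system_basis_def by auto
  moreover have "\<exists>!c. F = (\<lambda>x. \<Sum>i\<in>UNIV. c i * f i (q x))" if "F \<in> U" for F
  proof -
    have "F = (\<lambda>x. \<Sum>i\<in>UNIV. c i * f i (q x)) \<longleftrightarrow> (\<lambda>x. F (p x)) = (\<lambda>x. \<Sum>i\<in>UNIV. c i * f i x)" for c
    proof
      assume "(\<lambda>x. F (p x)) = (\<lambda>x. \<Sum>i\<in>UNIV. c i * f i x)"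
      \<comment> \<open>Evaluating at \<open>q x\<close> undoes the substitution
        \<open>p\<close>.\<close>
      from fun_cong[OF this, of "q _"] show "F = (\<lambda>x. \<Sum>i\<in>UNIV. c i * f i (q x))"
        unfolding inverse(1) by (rule ext)
    qed (simp add: inverse(2))
    moreover have "\<exists>!c. (\<lambda>x. F (p x)) = (\<lambda>x. \<Sum>i\<in>UNIV. c i * f i x)"
      using basis that unfolding U system_basis_def by blast
    ultimately show ?thesis by simp
  qed
  ultimately show ?thesis unfolding system_basis_def by blast
qed

text \<open>The transformed threefold is closed and contains the image. It is the smallest such set
  because a form vanishing on the image vanishes where all parameters are nonzero, hence everywhere
  by \<open>bs_map_density\<close>.\<close>

lemma proj_transform_W_BS_eq_closure:
  fixes A :: "complex ^ 14 ^ 14"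
  assumes A: "invertible A"
    and f: "\<And>s. (\<chi> i. f i s) = A *v sextic_map (q s)" and surj: "surj q"
  shows "proj_transform A W_BS = zariski_closure (rational_image f)"
  unfolding zariski_closure_def
proof (rule hull_unique[symmetric])
  show "rational_image f \<subseteq> proj_transform A W_BS"
  proof
    fix L assume "L \<in> rational_image f"
    then obtain s where s: "A *v sextic_map (q s) \<noteq> 0" "L = hpoint (A *v sextic_map (q s))"
      unfolding rational_image_def f by blast
    then have "sextic_map (q s) \<noteq> 0" by (metis matrix_vector_mult_0_right)
    then have "hpoint (sextic_map (q s)) \<in> W_BS"
      by (simp add: hpoint_in_W_BS_iff toric_sextic_map)
    then show "L \<in> proj_transform A W_BS"
      unfolding proj_transform_def s(2) by (intro image_eqI) (simp_all add: image_hpoint)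
  qed
  show "zariski_closed (proj_transform A W_BS)"
    using A zariski_closed_W_BS by (rule zariski_closed_proj_transform)
  fix Z assume sub: "rational_image f \<subseteq> Z" and "zariski_closed Z"
  then obtain \<F> where \<F>: "\<F> \<subseteq> (\<Union>d. forms d)" "Z = {L \<in> proj_space. \<forall>F\<in>\<F>. \<forall>v\<in>L. F v = 0}"
    unfolding zariski_closed_def by blast
  show "proj_transform A W_BS \<subseteq> Z"
  proof
    fix L assume "L \<in> proj_transform A W_BS"
    then obtain x y z where nz: "x \<noteq> 0" "y \<noteq> 0" "z \<noteq> 0" and L: "L = hpoint (A *v bs_map x y z)"
      unfolding proj_transform_def W_BS_def by (auto simp: image_hpoint)
    \<comment> \<open>The scalar \<open>c\<close> reaches every vector of the line \<open>L\<close>,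
      as membership in \<open>Z\<close> demands.\<close>
    have "F (c *s (A *v bs_map x y z)) = 0" if F: "F \<in> \<F>" for F c
    proof (rule bs_map_density[where G = "\<lambda>w. F (c *s (A *v w))"])
      have eq: "c *s (A *v w) = (\<chi> i j. c * A $ i $ j) *v w" for w
        by (simp add: vec_eq_iff matrix_vector_mult_def sum_distrib_left mult.assoc)
      obtain d where "F \<in> forms d" using F \<F>(1) by blast
      then show "continuous_on UNIV (\<lambda>w. F (c *s (A *v w)))"
        unfolding eq by (intro continuous_on_forms forms_compose_matrix)
    next
      fix x y z :: "complex ^ 2"
      assume xyz: "\<forall>i. x $ i \<noteq> 0 \<and> y $ i \<noteq> 0 \<and> z $ i \<noteq> 0"
      define r where "r = (x $ 1 * x $ 2 * y $ 1 * y $ 2 * z $ 1 * z $ 2)^2"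
      have r: "r \<noteq> 0" using xyz by (simp add: r_def)
      have "bs_map x y z \<noteq> 0"
        using xyz by (intro bs_map_nonzero) (simp_all add: vec2_nonzero_iff)
      then have nz: "A *v bs_map x y z \<noteq> 0" using A by (rule invertible_mult_nonzero[rotated])
      \<comment> \<open>Surjectivity realises the monomial substitution as \<open>q s\<close>, whose
        sextic image is \<open>r\<close> times the Bayle-Sano point.\<close>
      obtain s where "q s = vector [x $ 2 * y $ 2 * z $ 2, x $ 1 * y $ 1 * z $ 2,
          x $ 1 * y $ 2 * z $ 1, x $ 2 * y $ 1 * z $ 1]"
        using surj by (metis surjD)
      then have "(\<chi> i. f i s) = r *s (A *v bs_map x y z)"
        unfolding f by (simp add: sextic_map_eq_bs_map r_def vector_scalar_commute)
      moreover have "r *s (A *v bs_map x y z) \<noteq> 0"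
        using r nz by simp
      ultimately have "hpoint (r *s (A *v bs_map x y z)) \<in> rational_image f"
        unfolding rational_image_def mem_Collect_eq by (intro exI[of _ s]) simp
      then have "hpoint (r *s (A *v bs_map x y z)) \<in> Z"
        using sub by blast
      moreover have "c *s (A *v bs_map x y z) \<in> hpoint (r *s (A *v bs_map x y z))"
        unfolding hpoint_def vec.span_singleton
        by (rule image_eqI[of _ _ "c / r"]) (use r in simp_all)
      ultimately show "F (c *s (A *v bs_map x y z)) = 0"
        using F unfolding \<F>(2) by blast
    qed
    moreover have "L \<in> proj_space"
      unfolding proj_space_def L using invertible_mult_nonzero[OF A bs_map_nonzero[OF nz]] by blast
    ultimately show "L \<in> Z"
      unfolding \<F>(2) L hpoint_def vec.span_singleton by blast
  qed
qed

text \<open>The existence part shows that the system has a basis indexed by \<open>14\<close>, so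
  the statement about all bases is not vacuous.\<close>

theorem mainTheorem3:
  fixes v :: "4 \<Rightarrow> complex ^ 4"
  assumes "tetrahedron v"
  shows "(\<exists>f :: 14 \<Rightarrow> complex ^ 4 \<Rightarrow> complex. system_basis f (double_edge_sextics v)) \<and>
    (\<forall>f :: 14 \<Rightarrow> complex ^ 4 \<Rightarrow> complex. system_basis f (double_edge_sextics v) \<longrightarrow>
      (\<exists>A :: complex ^ 14 ^ 14. invertible A \<and>
        proj_transform A W_BS = zariski_closure (rational_image f)))"
proof -
  obtain P where P: "invertible P" "\<And>i. P *v axis i 1 = v i"
    using tetrahedron_matrix[OF assms] by blast
  then obtain Q where "P ** Q = mat 1" "Q ** P = mat 1"
    unfolding invertible_def by blast
  then have inverse: "P *v (Q *v x) = x" "Q *v (P *v x) = x" for x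
    by (simp_all add: matrix_vector_mul_assoc)
  have Q: "Q *v v i = axis i 1" for i
    using inverse(2)[of "axis i 1"] by (simp add: P(2))
  have "F \<in> double_edge_sextics v \<longleftrightarrow> (\<lambda>x. F (P *v x)) \<in> double_edge_sextics (\<lambda>i. axis i 1)" for F
  proof
    assume "(\<lambda>x. F (P *v x)) \<in> double_edge_sextics (\<lambda>i. axis i 1)"
    from double_edge_sextics_compose[OF this, of Q v] show "F \<in> double_edge_sextics v"
      by (simp add: Q inverse)
  qed (rule double_edge_sextics_compose, simp_all add: P(2))
  \<comment> \<open>Precomposition with \<open>Q\<close> carries the monomial basis from the
    coordinate tetrahedron to the given one.\<close>
  with system_basis_sextics_axis inverse
  have g: "system_basis (\<lambda>i x. monomial (sextic_exp i) (Q *v x)) (double_edge_sextics v)"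
    by (rule system_basis_compose)
  have surj: "surj (\<lambda>x. Q *v x)" using inverse(2) by (rule surjI)
  have "\<exists>A :: complex ^ 14 ^ 14. invertible A \<and>
      proj_transform A W_BS = zariski_closure (rational_image f)"
    if f: "system_basis f (double_edge_sextics v)" for f :: "14 \<Rightarrow> complex ^ 4 \<Rightarrow> complex"
  proof -
    \<comment> \<open>The required projectivity is the change of basis from the transported
      monomials to \<open>f\<close>.\<close>
    obtain A :: "complex ^ 14 ^ 14" where A: "invertible A"
      "\<And>x. (\<chi> i. f i x) = A *v (\<chi> i. monomial (sextic_exp i) (Q *v x))"
      using system_basis_change[OF f g] by blast
    have "proj_transform A W_BS = zariski_closure (rational_image f)"
      using A(1) A(2)[folded sextic_map_def] surj by (rule proj_transform_W_BS_eq_closure)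
    with A(1) show ?thesis by blast
  qed
  with g show ?thesis by blast
qed

end
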